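(* Assume A1–A5 and $k_n\asymp n^{2-4r}=n^{\frac{2}{1+4s}}$, where $0<r<1/2$ and $s=\frac{r}{2-4r}$. Then for every $P_0>0$ the ball $U=\bar{\mathbb B}^s_{2\infty}(P_0)$ is a maxiset (and $\bar{\mathbb B}^s_{2\infty}$ is the maxispace) for the test statistics $T_n(Y_n)$; that is: (i) with $V_n=\{g\in U:\ \|g\|\ge cn^{-r}\}$ ($c>0$ a fixed constant), there is a sequence of tests $K_n$ generated by $T_n$, with $\alpha(K_n)=\alpha(1+o(1))$, $0<\alpha<1$, such that $\limsup_{n\to\infty}(\alpha(K_n)+\beta(K_n,V_n))<1$; (ii) for every $f\in\mathbb L_2(0,1)$, $f\notin\bar{\mathbb B}^s_{2\infty}$, there are sequences of positive integers $i_n\to\infty$ and $m_n$ and constants $0<c_1<C_1$ with $c_1m_n^{-r}<\|\tilde f_{i_n}\|<C_1m_n^{-r}$ such that any sequence of tests $K_{m_n}$ generated by $T_{m_n}$ with $\alpha(K_{m_n})=\alpha(1+o(1))$, $0<\alpha<1$, satisfies $\liminf_{n\to\infty}(\alpha(K_{m_n})+\beta(K_{m_n},\tilde f_{i_n}))\ge1$.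
   Context: Model: one observes $dY_n(t)=f(t)dt+\frac{\sigma}{\sqrt n}dw(t)$, $t\in[0,1]$, $\sigma>0$, $f\in\mathbb L_2(0,1)$ unknown, $dw$ Gaussian white noise; $\|\cdot\|$ is the $\mathbb L_2(0,1)$ norm. $\phi_j$, $1\le j<\infty$, is an orthonormal basis of $\mathbb L_2(0,1)$, $\theta_j=\int f\phi_j\,dt$, $y_j=\int\phi_j\,dY_n=\theta_j+\frac{\sigma}{\sqrt n}\xi_j$ with $\xi_j$ i.i.d. $N(0,1)$. The hypothesis is $H_0:f=0$. For a test $K_n$, $\alpha(K_n)$ is the type I error probability, $\beta(K_n,f)$ the type II error probability at $f$, $\beta(K_n,V)=\sup_{f\in V}\beta(K_n,f)$. A test is generated by $T_n$ if it rejects $H_0$ when $T_n$ exceeds a threshold. $a_n\asymp b_n$ means $ca_n\le b_n\le Ca_n$ for all $n$ with constants $0<c\le C$. Test statistics: $T_n(Y_n)=\sum_{j=1}^\infty\kappa_{jn}^2y_j^2-\sigma^2n^{-1}\sum_{j=1}^\infty\kappa_{jn}^2$, with $k_n=\sup\{k:\sum_{j<k}\kappa_{jn}^2\le\frac12\sum_{j=1}^\infty\kappa_{jn}^2\}$. Non-integer indices are replaced by integer parts. Assumptions: A1. For each $n$ the sequence $\kappa^2_{jn}$ is decreasing in $j$. A2. There are positive constants $C_1,C_2$ with $C_1<A_n=\sigma^{-4}n^2\sum_{j=1}^\infty\kappa_{jn}^4<C_2$ for each $n$. A3. For any $0<\delta<1/2$, $\lim_{n\to\infty}\sup_{\delta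 k_n<j<\delta^{-1}k_n}\left|\kappa^2_{j+1,n}/\kappa^2_{j,n}-1\right|=0$. A4. For any $\delta>0$ and any $0\le\delta_1<1$ there are constants $C_1>0$ and $C_2<1$ with $C_1<\kappa^2_{(1+\delta)k_n,n}/\kappa^2_{(1-\delta_1)k_n,n}<C_2$. A5. $\lim_{\delta\to0}\lim_{n\to\infty}\frac{\sum_{\delta k_n<j<\delta^{-1}k_n}\kappa_{jn}^2}{\sum_{j=1}^\infty\kappa_{jn}^2}=1$ and $\lim_{\delta\to0}\lim_{n\to\infty}A_n^{-1}\sigma^{-4}n^2\sum_{\delta k_n<j<\delta^{-1}k_n}\kappa_{jn}^4=1$. Balls: $\bar{\mathbb B}^s_{2\infty}(P_0)=\{f=\sum_{j\ge1}\theta_j\phi_j:\ \sup_{\lambda>0}\lambda^{2s}\sum_{j>\lambda}\theta_j^2\le P_0,\ \theta_j\in\mathbb R\}$, and $\bar{\mathbb B}^s_{2\infty}=\bigcup_{P_0>0}\bar{\mathbb B}^s_{2\infty}(P_0)$. Functions $\tilde f_i$: for a ball $U$, $e_1\in U$ is an element of maximal norm, $\Pi_1=\mathrm{span}(e_1)$, and inductively $e_i\in U$ maximizes the $\mathbb L_2$ distance to $\Pi_{i-1}$ over $U$, $\Pi_i=\mathrm{span}(e_1,\dots,e_i)$; $\tilde f_i=f-f_{\Pi_i}$, where $f_{\Pi_i}$ is the orthogonal projection of $f$ on $\Pi_i$. In the present setting $e_i$ is taken to be a multiple of $\phi_i$, so $\Pi_i=\mathrm{span}(\phi_1,\dots,\phi_i)$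 and $\tilde f_i=\sum_{j>i}\theta_j\phi_j$. *)

theory Defs
  imports "HOL-Probability.Probability"
begin

text \<open>
  The space $L_2(0,1)$. Its elements are represented by functions, not by classes of functions
  modulo equality almost everywhere. Values outside of $(0,1)$ are irrelevant.
\<close>

definition L2 :: "(real \<Rightarrow> real) set" where
  "L2 = {f \<in> borel_measurable (lebesgue_on {0<..<1}).
           integrable (lebesgue_on {0<..<1}) (\<lambda>t. (f t)\<^sup>2)}"

definition ip :: "(real \<Rightarrow> real) \<Rightarrow> (real \<Rightarrow> real) \<Rightarrow> real" where
  "ip f g = integral\<^sup>L (lebesgue_on {0<..<1}) (\<lambda>t. f t * g t)"

definition l2norm :: "(real \<Rightarrow> real) \<Rightarrow> real" where
  "l2norm f = sqrt (ip f f)"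

text \<open>
  Bases, coefficients and all other sequences in \<open>j\<close> are indexed by \<open>j \<ge> 1\<close>;
  the entry at index 0 is ignored. Accordingly, a series over \<open>j \<ge> 1\<close> is written
  \<open>\<Sum>j. a (Suc j)\<close>.
\<close>

definition orthonormal :: "(nat \<Rightarrow> real \<Rightarrow> real) \<Rightarrow> bool" where
  "orthonormal e \<longleftrightarrow> (\<forall>j\<ge>1. e j \<in> L2) \<and>
     (\<forall>i\<ge>1. \<forall>j\<ge>1. ip (e i) (e j) = (if i = j then 1 else 0))"

definition orthonormal_basis :: "(nat \<Rightarrow> real \<Rightarrow> real) \<Rightarrow> bool" where
  "orthonormal_basis \<phi> \<longleftrightarrow> orthonormal \<phi> \<and>
     (\<forall>f\<in>L2. (\<lambda>N. l2norm (\<lambda>t. f t - (\<Sum>j=1..N. ip f (\<phi> j) * \<phi> j t))) \<longlonglongrightarrow> 0)"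

text \<open>
  Gaussian white noise is given by its stochastic integrals: \<open>w g\<close> is the random variable
  $\int_0^1 g(t)\,dw(t)$. The integral is linear up to null sets, and it sends orthonormal
  sequences to sequences of independent standard normal variables.
\<close>

definition white_noise :: "'a measure \<Rightarrow> ((real \<Rightarrow> real) \<Rightarrow> 'a \<Rightarrow> real) \<Rightarrow> bool" where
  "white_noise M w \<longleftrightarrow>
     prob_space M \<and>
     (\<forall>g\<in>L2. w g \<in> borel_measurable M) \<and>
     (\<forall>g\<in>L2. \<forall>h\<in>L2. \<forall>a b. AE \<omega> in M. w (\<lambda>t. a * g t + b * h t) \<omega> = a * w g \<omega> + b * w h \<omega>) \<and>
     (\<forall>e. orthonormal e \<longrightarrow>
        prob_space.indep_vars M (\<lambda>_. borel) (\<lambda>j. w (e j)) {1..} \<and>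
        (\<forall>j\<ge>1. distributed M lborel (w (e j)) std_normal_density))"

text \<open>
  An observation \<open>Y\<close> is likewise given by its integrals, \<open>Y g\<close> standing for
  $\int_0^1 g(t)\,dY(t)$. The following is $dY_n(t) = f(t)\,dt + \frac{\sigma}{\sqrt n}\,dw(t)$.
\<close>

type_synonym observation = "(real \<Rightarrow> real) \<Rightarrow> real"

definition observe ::
  "((real \<Rightarrow> real) \<Rightarrow> 'a \<Rightarrow> real) \<Rightarrow> real \<Rightarrow> nat \<Rightarrow> (real \<Rightarrow> real) \<Rightarrow> 'a \<Rightarrow> observation" where
  "observe w \<sigma> n f \<omega> = (\<lambda>g. ip f g + \<sigma> / sqrt (real n) * w g \<omega>)"

text \<open>A test is the predicate on observations that tells when the hypothesis is rejected.\<close>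

type_synonym test = "observation \<Rightarrow> bool"

definition generated_by :: "(observation \<Rightarrow> real) \<Rightarrow> test \<Rightarrow> bool" where
  "generated_by T K \<longleftrightarrow> (\<exists>c. \<forall>Y. K Y \<longleftrightarrow> T Y > c)"

definition type1_error ::
  "'a measure \<Rightarrow> ((real \<Rightarrow> real) \<Rightarrow> 'a \<Rightarrow> real) \<Rightarrow> real \<Rightarrow> nat \<Rightarrow> test \<Rightarrow> real" where
  "type1_error M w \<sigma> n K = measure M {\<omega> \<in> space M. K (observe w \<sigma> n (\<lambda>_. 0) \<omega>)}"

definition type2_error ::
  "'a measure \<Rightarrow> ((real \<Rightarrow> real) \<Rightarrow> 'a \<Rightarrow> real) \<Rightarrow> real \<Rightarrow> nat \<Rightarrow> test \<Rightarrow> (real \<Rightarrow> real) \<Rightarrow> real" where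
  "type2_error M w \<sigma> n K f = measure M {\<omega> \<in> space M. \<not> K (observe w \<sigma> n f \<omega>)}"

definition type2_error_sup ::
  "'a measure \<Rightarrow> ((real \<Rightarrow> real) \<Rightarrow> 'a \<Rightarrow> real) \<Rightarrow> real \<Rightarrow> nat \<Rightarrow> test \<Rightarrow> (real \<Rightarrow> real) set \<Rightarrow> real" where
  "type2_error_sup M w \<sigma> n K V = (SUP f\<in>V. type2_error M w \<sigma> n K f)"

definition test_stat ::
  "(nat \<Rightarrow> nat \<Rightarrow> real) \<Rightarrow> real \<Rightarrow> (nat \<Rightarrow> real \<Rightarrow> real) \<Rightarrow> nat \<Rightarrow> observation \<Rightarrow> real" where
  "test_stat \<kappa> \<sigma> \<phi> n Y =
     (\<Sum>j. (\<kappa> (Suc j) n)\<^sup>2 * (Y (\<phi> (Suc j)))\<^sup>2) - \<sigma>\<^sup>2 / real n * (\<Sum>j. (\<kappa> (Suc j) n)\<^sup>2)"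

text \<open>
  The set in the following definition contains 1, and it is finite as soon as the coefficients
  \<open>(\<kappa> j n)\<^sup>2\<close>, \<open>j \<ge> 1\<close>, are summable with a positive sum.
\<close>

definition k_index :: "(nat \<Rightarrow> nat \<Rightarrow> real) \<Rightarrow> nat \<Rightarrow> nat" where
  "k_index \<kappa> n = Sup {k. (\<Sum>j\<in>{1..<k}. (\<kappa> j n)\<^sup>2) \<le> 1/2 * (\<Sum>j. (\<kappa> (Suc j) n)\<^sup>2)}"

definition A_seq :: "(nat \<Rightarrow> nat \<Rightarrow> real) \<Rightarrow> real \<Rightarrow> nat \<Rightarrow> real" where
  "A_seq \<kappa> \<sigma> n = (real n)\<^sup>2 / \<sigma> ^ 4 * (\<Sum>j. (\<kappa> (Suc j) n) ^ 4)"

definition window :: "(nat \<Rightarrow> nat \<Rightarrow> real) \<Rightarrow> real \<Rightarrow> nat \<Rightarrow> nat set" where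
  "window \<kappa> \<delta> n =
     {j. \<delta> * real (k_index \<kappa> n) < real j \<and> real j < real (k_index \<kappa> n) / \<delta>}"

definition assumption_A1 :: "(nat \<Rightarrow> nat \<Rightarrow> real) \<Rightarrow> bool" where
  "assumption_A1 \<kappa> \<longleftrightarrow> (\<forall>n\<ge>1. \<forall>j\<ge>1. (\<kappa> (j + 1) n)\<^sup>2 \<le> (\<kappa> j n)\<^sup>2)"

definition assumption_A2 :: "(nat \<Rightarrow> nat \<Rightarrow> real) \<Rightarrow> real \<Rightarrow> bool" where
  "assumption_A2 \<kappa> \<sigma> \<longleftrightarrow>
     (\<exists>C1>0. \<exists>C2>0. \<forall>n\<ge>1. C1 < A_seq \<kappa> \<sigma> n \<and> A_seq \<kappa> \<sigma> n < C2)"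

definition assumption_A3 :: "(nat \<Rightarrow> nat \<Rightarrow> real) \<Rightarrow> bool" where
  "assumption_A3 \<kappa> \<longleftrightarrow>
     (\<forall>\<delta>. 0 < \<delta> \<and> \<delta> < 1/2 \<longrightarrow>
        (\<lambda>n. SUP j\<in>window \<kappa> \<delta> n. \<bar>(\<kappa> (j + 1) n)\<^sup>2 / (\<kappa> j n)\<^sup>2 - 1\<bar>) \<longlonglongrightarrow> 0)"

text \<open>
  The next condition is required for all large \<open>n\<close> only: for fixed \<open>n\<close> and
  small \<open>\<delta>\<close> the two integer parts can coincide, or the lower one can be 0.
\<close>

definition assumption_A4 :: "(nat \<Rightarrow> nat \<Rightarrow> real) \<Rightarrow> bool" where
  "assumption_A4 \<kappa> \<longleftrightarrow>
     (\<forall>\<delta>>0. \<forall>\<delta>1. 0 \<le> \<delta>1 \<and> \<delta>1 < 1 \<longrightarrow>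
        (\<exists>C1>0. \<exists>C2<1. \<forall>\<^sub>F n in sequentially.
           (let q = (\<kappa> (nat \<lfloor>(1 + \<delta>) * real (k_index \<kappa> n)\<rfloor>) n)\<^sup>2 /
                    (\<kappa> (nat \<lfloor>(1 - \<delta>1) * real (k_index \<kappa> n)\<rfloor>) n)\<^sup>2
            in C1 < q \<and> q < C2)))"

text \<open>Iterated limits: the inner limit over \<open>n\<close> is named \<open>L \<delta>\<close>.\<close>

definition iterated_limit :: "(real \<Rightarrow> nat \<Rightarrow> real) \<Rightarrow> real \<Rightarrow> bool" where
  "iterated_limit a l \<longleftrightarrow>
     (\<exists>L. (\<forall>\<^sub>F \<delta> in at_right 0. (\<lambda>n. a \<delta> n) \<longlonglongrightarrow> L \<delta>) \<and> (L \<longlongrightarrow> l) (at_right 0))"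

definition assumption_A5 :: "(nat \<Rightarrow> nat \<Rightarrow> real) \<Rightarrow> real \<Rightarrow> bool" where
  "assumption_A5 \<kappa> \<sigma> \<longleftrightarrow>
     iterated_limit (\<lambda>\<delta> n. (\<Sum>j\<in>window \<kappa> \<delta> n. (\<kappa> j n)\<^sup>2) / (\<Sum>j. (\<kappa> (Suc j) n)\<^sup>2)) 1 \<and>
     iterated_limit (\<lambda>\<delta> n. (real n)\<^sup>2 / \<sigma> ^ 4 * (\<Sum>j\<in>window \<kappa> \<delta> n. (\<kappa> j n) ^ 4) / A_seq \<kappa> \<sigma> n) 1"

text \<open>
  The parameter \<open>\<lambda>\<close> of the balls is a positive real; the values \<open>\<lambda> < 1\<close>
  bound the whole norm.
\<close>

definition besov_ball :: "(nat \<Rightarrow> real \<Rightarrow> real) \<Rightarrow> real \<Rightarrow> real \<Rightarrow> (real \<Rightarrow> real) set" where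
  "besov_ball \<phi> s P =
     {f \<in> L2. \<forall>l>0. l powr (2 * s) *
        (\<Sum>j. if l < real (Suc j) then (ip f (\<phi> (Suc j)))\<^sup>2 else 0) \<le> P}"

definition besov_space :: "(nat \<Rightarrow> real \<Rightarrow> real) \<Rightarrow> real \<Rightarrow> (real \<Rightarrow> real) set" where
  "besov_space \<phi> s = (\<Union>P\<in>{0<..}. besov_ball \<phi> s P)"

definition span_first :: "(nat \<Rightarrow> real \<Rightarrow> real) \<Rightarrow> nat \<Rightarrow> (real \<Rightarrow> real) set" where
  "span_first e m = {\<lambda>t. \<Sum>j=1..m. a j * e j t | a :: nat \<Rightarrow> real. True}"

definition l2dist :: "(real \<Rightarrow> real) \<Rightarrow> (real \<Rightarrow> real) set \<Rightarrow> real" where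
  "l2dist g S = (INF h\<in>S. l2norm (\<lambda>t. g t - h t))"

text \<open>
  For \<open>i = 1\<close> the span is the zero space, so \<open>e 1\<close> has maximal norm in \<open>U\<close>.
\<close>

definition greedy_sequence :: "(real \<Rightarrow> real) set \<Rightarrow> (nat \<Rightarrow> real \<Rightarrow> real) \<Rightarrow> bool" where
  "greedy_sequence U e \<longleftrightarrow>
     (\<forall>i\<ge>1. e i \<in> U \<and>
        (\<forall>g\<in>U. l2dist g (span_first e (i - 1)) \<le> l2dist (e i) (span_first e (i - 1))))"

definition orth_proj :: "(real \<Rightarrow> real) set \<Rightarrow> (real \<Rightarrow> real) \<Rightarrow> (real \<Rightarrow> real)" where
  "orth_proj S f = (SOME p. p \<in> S \<and> (\<forall>h\<in>S. ip (\<lambda>t. f t - p t) h = 0))"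

definition f_tilde :: "(nat \<Rightarrow> real \<Rightarrow> real) \<Rightarrow> (real \<Rightarrow> real) \<Rightarrow> nat \<Rightarrow> (real \<Rightarrow> real)" where
  "f_tilde e f i = (\<lambda>t. f t - orth_proj (span_first e i) f t)"

end

theory Submission
  imports Defs
begin

text \<open>
  After dividing the statistic by its standard deviation under the hypothesis, its value at $g$ is
  $S_n + h_n(g) + R_n(g)$: $S_n$ is a weighted sum of centred squares of independent standard
  normal variables, $h_n(g) \ge 0$ is a deterministic shift, and $R_n(g)$ is a centred linear term
  whose variance is at most $4\,h_n(g)$ times the largest weight. That weight tends to 0 by (A5), so
  $S_n$ is asymptotically standard normal, and $g$ is detected or missed according to $h_n(g)$.

  On the ball, the coefficients with index above $D k_n$ carry at most half of
  $\|g\|^2 \ge c^2 n^{-2r}$ once $D$ is large, while (A2), (A4) and (A5) bound the weights below index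
  $D k_n$ from below by a multiple of $k_n^{-1/2}$; hence $h_n(g)$ is bounded away from 0. Conversely,
  the $i$-th weight is at most $(2i)^{-1/2}$, so $h_m(\tilde f_i)$ is at most a multiple of
  $m^{1-2r} i^{-1/2}$ when $\|\tilde f_i\| \asymp m^{-r}$. If $f$ is outside the space, $i$ and $m$ can
  be chosen so that this tends to 0.
\<close>

subsection \<open>The standard normal distribution and weighted sums of squares\<close>

text \<open>The relation \<open>s = r / (2 - 4 * r)\<close> says that
  \<open>(2 - 4 * r) * (2 * s) = 2 * r\<close>. Cutting an element of the ball at an index of order
  n^(2-4r) therefore loses squared norm of order n^(-2r), the squared detection radius, and weights
  of order k_n^(-1/2) turn a squared norm n^(-2r) into a shift of constant order. Outside the space
  the same exponents apply: if t is the squared norm beyond index i and m^(-r) = t^(1/2), then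
  m^(1-2r) i^(-1/2) = (i^(2s) t)^(-1/(4s)), and i^(2s) t is unbounded.

  Two obstacles shape the rest. The type II error has to be bounded uniformly over the alternatives,
  so the linear term is compared with the shift of the same g, not with a fixed level. In the
  negative part the thresholds are arbitrary; all that is known of them is the limit of the type I
  errors, and strict monotonicity of the normal distribution function turns this into an asymptotic
  lower bound for the normalised thresholds.\<close>

lemma std_normal_cdf_isCont: "isCont (cdf std_normal_distribution) x"
proof -
  interpret real_distribution std_normal_distribution by (rule real_dist_normal_dist)
  have "emeasure std_normal_distribution {x} = 0"
    by (subst emeasure_density) (auto intro!: nn_integral_null_delta simp: null_sets_def)
  then show ?thesis by (simp add: isCont_cdf measure_def)
qed

text \<open>The density vanishes nowhere, so a null interval would be Lebesgue null. Strictness is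
  what turns a shift bounded away from 0 into a gap between the sum of the errors and 1.\<close>

lemma std_normal_cdf_strict_mono:
  assumes "x < y" shows "cdf std_normal_distribution x < cdf std_normal_distribution y"
proof -
  interpret real_distribution std_normal_distribution by (rule real_dist_normal_dist)
  have "emeasure std_normal_distribution {x<..y} \<noteq> 0"
  proof
    assume "emeasure std_normal_distribution {x<..y} = 0"
    then have "{x<..y} \<in> null_sets std_normal_distribution" by (auto simp: null_sets_def)
    then have "AE z in lborel. z \<in> {x<..y} \<longrightarrow> std_normal_density z = 0"
      by (subst (asm) null_sets_density_iff) auto
    moreover have "std_normal_density z \<noteq> 0" for z
      using normal_density_pos[of 1 0 z] by simp
    ultimately have "AE z in lborel. z \<notin> {x<..y}" by auto
    then have "emeasure lborel {x<..y} = 0"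
      by (subst (asm) AE_iff_measurable[of "{x<..y}"]) auto
    then show False using assms by simp
  qed
  then have "measure std_normal_distribution {x<..y} > 0"
    by (simp add: emeasure_eq_measure zero_less_measure_iff)
  then show ?thesis using cdf_diff_eq[OF assms] by simp
qed

lemma std_normal_quantile:
  assumes "0 < p" "p < 1" shows "\<exists>z. cdf std_normal_distribution z = p"
proof -
  interpret real_distribution std_normal_distribution by (rule real_dist_normal_dist)
  let ?F = "cdf std_normal_distribution"
  have "\<forall>\<^sub>F x in at_top. ?F x > p"
    using order_tendstoD(1)[OF cdf_lim_at_top_prob] assms by blast
  then obtain b where b: "\<And>x. x \<ge> b \<Longrightarrow> ?F x > p" by (auto simp: eventually_at_top_linorder)
  have "\<forall>\<^sub>F x in at_bot. ?F x < p"
    using order_tendstoD(2)[OF cdf_lim_at_bot] assms by blast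
  then obtain a where a: "\<And>x. x \<le> a \<Longrightarrow> ?F x < p" by (auto simp: eventually_at_bot_linorder)
  have "\<exists>z. min a b \<le> z \<and> z \<le> b \<and> ?F z = p"
    using a[of "min a b"] b[of b]
    by (intro IVT') (auto intro!: continuous_at_imp_continuous_on std_normal_cdf_isCont less_imp_le)
  then show ?thesis by blast
qed

text \<open>Compares the expansion 1 - u of a characteristic function with the Gaussian factor
  exp(-u). The upper half follows from exp(-u) <= 1/(1+u) and (1 - u + u^2)(1 + u) = 1 +
  u^3.\<close>

lemma exp_minus_linear_bound:
  assumes "(u::real) \<ge> 0" shows "\<bar>exp (- u) - (1 - u)\<bar> \<le> u\<^sup>2"
proof -
  have 1: "1 - u \<le> exp (-u)" using exp_ge_add_one_self[of "-u"] by simp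
  have "(1 + u) * exp (-u) \<le> exp u * exp (-u)"
    using exp_ge_add_one_self[of u] by (intro mult_right_mono) auto
  then have "exp (-u) \<le> 1 / (1+u)" using assms by (simp add: exp_minus field_simps)
  also have "\<dots> \<le> 1 - u + u\<^sup>2"
  proof -
    have "1 \<le> 1 + u ^ 3" using assms by simp
    also have "\<dots> = (1 - u + u\<^sup>2) * (1+u)" by (simp add: power2_eq_square power3_eq_cube algebra_simps)
    finally show ?thesis using assms by (simp add: divide_le_eq)
  qed
  finally show ?thesis using 1 by auto
qed

text \<open>The index set starts at 1 and nothing is known about \<open>X 0\<close>; hence all
  series below run over \<open>X (Suc j)\<close>.\<close>

locale iid_std_normal = prob_space M for M :: "'a measure" +
  fixes X :: "nat \<Rightarrow> 'a \<Rightarrow> real"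
  assumes indep: "indep_vars (\<lambda>_. borel) X {1..}"
    and distr_normal: "\<And>j. j \<ge> 1 \<Longrightarrow> distributed M lborel (X j) std_normal_density"
begin

section \<open>Moments and series of independent standard normal variables\<close>

lemma rv [measurable]: "X (Suc j) \<in> borel_measurable M"
  using distributed_measurable[OF distr_normal[of "Suc j"]] by simp

lemma
  shows moment_integrable: "integrable M (\<lambda>\<omega>. X (Suc j) \<omega> ^ k)"
    and moment_eq: "expectation (\<lambda>\<omega>. X (Suc j) \<omega> ^ k) = (\<integral>x. std_normal_density x * x ^ k \<partial>lborel)"
proof -
  have d: "distributed M lborel (X (Suc j)) std_normal_density" by (rule distr_normal) simp
  show "integrable M (\<lambda>\<omega>. X (Suc j) \<omega> ^ k)"
    using distributed_integrable[OF d, of "\<lambda>x. x ^ k"] integrable_std_normal_moment[of k] by simp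
  show "expectation (\<lambda>\<omega>. X (Suc j) \<omega> ^ k) = (\<integral>x. std_normal_density x * x ^ k \<partial>lborel)"
    using distributed_integral[OF d, of "\<lambda>x. x ^ k"] by simp
qed

lemma mean: "expectation (X (Suc j)) = 0"
  using moment_eq[of j 1] integral_std_normal_moment_odd[of 0] by simp

lemma second_moment: "expectation (\<lambda>\<omega>. (X (Suc j) \<omega>)\<^sup>2) = 1"
  using moment_eq[of j 2] integral_std_normal_moment_even[of 1] by (simp add: fact_numeral)

lemma fourth_moment: "expectation (\<lambda>\<omega>. X (Suc j) \<omega> ^ 4) = 3"
  using moment_eq[of j 4] integral_std_normal_moment_even[of 2] by (simp add: fact_numeral)

lemma expectation_mult:
  "expectation (\<lambda>\<omega>. X (Suc i) \<omega> * X (Suc j) \<omega>) = (if i = j then 1 else 0)"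
  "integrable M (\<lambda>\<omega>. X (Suc i) \<omega> * X (Suc j) \<omega>)"
proof -
  have *: "expectation (\<lambda>\<omega>. X (Suc i) \<omega> * X (Suc j) \<omega>) = 0 \<and>
     integrable M (\<lambda>\<omega>. X (Suc i) \<omega> * X (Suc j) \<omega>)" if "i \<noteq> j"
  proof -
    have iv: "indep_vars (\<lambda>_. borel) X {Suc i, Suc j}" by (rule indep_vars_subset[OF indep]) auto
    have int: "integrable M (X (Suc k))" for k using moment_integrable[of k 1] by simp
    show ?thesis
      using indep_vars_lebesgue_integral[OF _ iv] indep_vars_integrable[OF _ iv] int mean that
      by auto
  qed
  show "expectation (\<lambda>\<omega>. X (Suc i) \<omega> * X (Suc j) \<omega>) = (if i = j then 1 else 0)"
    using * second_moment[of i] by (auto simp: power2_eq_square)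
  show "integrable M (\<lambda>\<omega>. X (Suc i) \<omega> * X (Suc j) \<omega>)"
    using * moment_integrable[of i 2] by (cases "i = j") (auto simp: power2_eq_square)
qed

text \<open>By monotone convergence the expectation of the series is the finite sum of the
  \<open>a j\<close>, so the series is finite almost everywhere.\<close>

lemma AE_summable_weighted_squares:
  assumes a: "\<And>j. a j \<ge> 0" "summable a"
  shows "AE \<omega> in M. summable (\<lambda>j. a j * (X (Suc j) \<omega>)\<^sup>2)"
proof -
  have 1: "(\<integral>\<^sup>+\<omega>. ennreal (a j * (X (Suc j) \<omega>)\<^sup>2) \<partial>M) = ennreal (a j)" for j
    using moment_integrable[of j 2] second_moment[of j] a(1)[of j]
    by (subst nn_integral_eq_integral) auto
  have "(\<integral>\<^sup>+\<omega>. (\<Sum>j. ennreal (a j * (X (Suc j) \<omega>)\<^sup>2)) \<partial>M) = (\<Sum>j. ennreal (a j))"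
    by (subst nn_integral_suminf) (auto simp: 1)
  also have "\<dots> \<noteq> \<infinity>" using a by (simp add: suminf_ennreal2)
  finally have "AE \<omega> in M. (\<Sum>j. ennreal (a j * (X (Suc j) \<omega>)\<^sup>2)) \<noteq> \<infinity>"
    by (intro nn_integral_PInf_AE) auto
  then show ?thesis
    by (rule AE_mp, intro AE_I2 impI summable_suminf_not_top) (auto simp: a)
qed

text \<open>Chebyshev's inequality for an infinite series. Orthogonality gives the second moments of
  the partial sums, and Fatou's lemma carries their common bound to the limit. Almost sure
  summability is assumed because \<open>suminf\<close> is the limit of the partial sums only where
  the series converges.\<close>

lemma prob_series_ge:
  assumes c: "summable (\<lambda>j. (c j)\<^sup>2)" and \<epsilon>: "\<epsilon> > 0"
    and s: "AE \<omega> in M. summable (\<lambda>j. c j * X (Suc j) \<omega>)"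
  shows "prob {\<omega> \<in> space M. \<bar>\<Sum>j. c j * X (Suc j) \<omega>\<bar> \<ge> \<epsilon>} \<le> (\<Sum>j. (c j)\<^sup>2) / \<epsilon>\<^sup>2"
proof -
  define V where "V = (\<Sum>j. (c j)\<^sup>2)"
  have V0: "V \<ge> 0" unfolding V_def using c by (intro suminf_nonneg) auto
  let ?C = "\<lambda>\<omega>. \<Sum>j. c j * X (Suc j) \<omega>"
  let ?P = "\<lambda>N \<omega>. \<Sum>j<N. c j * X (Suc j) \<omega>"
  have sq: "(?P N \<omega>)\<^sup>2 = (\<Sum>i<N. \<Sum>j<N. c i * c j * (X (Suc i) \<omega> * X (Suc j) \<omega>))" for N \<omega>
    by (simp add: power2_eq_square sum_product mult_ac)
  have int: "integrable M (\<lambda>\<omega>. (?P N \<omega>)\<^sup>2)" for N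
    unfolding sq by (intro Bochner_Integration.integrable_sum Bochner_Integration.integrable_mult_right expectation_mult(2))
  have "expectation (\<lambda>\<omega>. (?P N \<omega>)\<^sup>2) = (\<Sum>i<N. \<Sum>j<N. c i * c j * (if i = j then 1 else 0))" for N
    unfolding sq
    by (subst Bochner_Integration.integral_sum
          , intro Bochner_Integration.integrable_sum Bochner_Integration.integrable_mult_right expectation_mult(2))+
       (simp add: expectation_mult)
  then have "expectation (\<lambda>\<omega>. (?P N \<omega>)\<^sup>2) = (\<Sum>i<N. (c i)\<^sup>2)" for N
    by (simp add: power2_eq_square if_distrib cong: if_cong)
  then have le: "(\<integral>\<^sup>+\<omega>. ennreal ((?P N \<omega>)\<^sup>2) \<partial>M) \<le> ennreal V" for N
    using int[of N] c
    by (subst nn_integral_eq_integral) (auto simp: V_def intro!: ennreal_leI sum_le_suminf)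
  have "(\<integral>\<^sup>+\<omega>. ennreal ((?C \<omega>)\<^sup>2) \<partial>M) = (\<integral>\<^sup>+\<omega>. liminf (\<lambda>N. ennreal ((?P N \<omega>)\<^sup>2)) \<partial>M)"
  proof (rule nn_integral_cong_AE, rule AE_mp[OF s], intro AE_I2 impI)
    fix \<omega> assume "summable (\<lambda>j. c j * X (Suc j) \<omega>)"
    then have "(\<lambda>N. ?P N \<omega>) \<longlonglongrightarrow> ?C \<omega>" by (rule summable_LIMSEQ)
    then have "(\<lambda>N. ennreal ((?P N \<omega>)\<^sup>2)) \<longlonglongrightarrow> ennreal ((?C \<omega>)\<^sup>2)"
      by (intro tendsto_ennrealI tendsto_power)
    then show "ennreal ((?C \<omega>)\<^sup>2) = liminf (\<lambda>N. ennreal ((?P N \<omega>)\<^sup>2))"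
      by (intro lim_imp_Liminf[symmetric]) auto
  qed
  also have "\<dots> \<le> liminf (\<lambda>N. \<integral>\<^sup>+\<omega>. ennreal ((?P N \<omega>)\<^sup>2) \<partial>M)"
    by (rule nn_integral_liminf) simp
  also have "\<dots> \<le> liminf (\<lambda>N::nat. ennreal V)"
    by (intro Liminf_mono always_eventually) (use le in auto)
  also have "\<dots> = ennreal V" by (simp add: Liminf_const)
  finally have E: "(\<integral>\<^sup>+\<omega>. ennreal ((?C \<omega>)\<^sup>2) \<partial>M) \<le> ennreal V" .
  have "emeasure M {\<omega> \<in> space M. \<bar>?C \<omega>\<bar> \<ge> \<epsilon>} \<le>
        emeasure M {\<omega> \<in> space M. 1 \<le> ennreal (1/\<epsilon>\<^sup>2) * ennreal ((?C \<omega>)\<^sup>2)}"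
  proof (intro emeasure_mono subsetI CollectI conjI)
    fix \<omega> assume *: "\<omega> \<in> {\<omega> \<in> space M. \<epsilon> \<le> \<bar>?C \<omega>\<bar>}"
    then have "\<epsilon>\<^sup>2 \<le> (?C \<omega>)\<^sup>2" using \<epsilon> by (metis (mono_tags, lifting) mem_Collect_eq less_imp_le power2_abs power_mono)
    then have "1 \<le> 1/\<epsilon>\<^sup>2 * (?C \<omega>)\<^sup>2" using \<epsilon> by (simp add: field_simps)
    then show "1 \<le> ennreal (1/\<epsilon>\<^sup>2) * ennreal ((?C \<omega>)\<^sup>2)"
      using \<epsilon> by (simp add: ennreal_mult'[symmetric])
  qed auto
  also have "\<dots> \<le> ennreal (1/\<epsilon>\<^sup>2) * (\<integral>\<^sup>+\<omega>. ennreal ((?C \<omega>)\<^sup>2) * indicator (space M) \<omega> \<partial>M)"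
    by (rule nn_integral_Markov_inequality) auto
  also have "(\<integral>\<^sup>+\<omega>. ennreal ((?C \<omega>)\<^sup>2) * indicator (space M) \<omega> \<partial>M) = (\<integral>\<^sup>+\<omega>. ennreal ((?C \<omega>)\<^sup>2) \<partial>M)"
    by (rule nn_integral_cong) simp
  also have "ennreal (1/\<epsilon>\<^sup>2) * \<dots> \<le> ennreal (1/\<epsilon>\<^sup>2) * ennreal V" by (intro mult_left_mono E) auto
  also have "\<dots> = ennreal (V / \<epsilon>\<^sup>2)" using V0 by (simp add: ennreal_mult[symmetric])
  finally show ?thesis using V0 \<epsilon> unfolding V_def[symmetric] emeasure_eq_measure
    by (subst (asm) ennreal_le_iff) auto
qed

text \<open>Third-order Taylor bound for a centred square, which has mean 0, variance 2 and a finite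
  third absolute moment. One constant serves every j because the moments depend only on the common
  distribution.\<close>

lemma chi_square_char_bound:
  obtains C where "C \<ge> 0"
    "\<And>j t. cmod (char (distr M borel (\<lambda>\<omega>. (X (Suc j) \<omega>)\<^sup>2 - 1)) t - (1 - t\<^sup>2)) \<le> C * \<bar>t\<bar> ^ 3"
proof -
  define C where "C = expectation (\<lambda>\<omega>. (X (Suc 0) \<omega> ^ 6 + 3 * X (Suc 0) \<omega> ^ 4 + 3 * (X (Suc 0) \<omega>)^2 + 1))"
  have Ceq: "C = expectation (\<lambda>\<omega>. (X (Suc j) \<omega> ^ 6 + 3 * X (Suc j) \<omega> ^ 4 + 3 * (X (Suc j) \<omega>)^2 + 1))" for j
    using moment_eq moment_integrable unfolding C_def by simp
  have intC: "integrable M (\<lambda>\<omega>. (X (Suc j) \<omega> ^ 6 + 3 * X (Suc j) \<omega> ^ 4 + 3 * (X (Suc j) \<omega>)^2 + 1))" for j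
    using moment_integrable by simp
  have C0: "C \<ge> 0" unfolding C_def by (intro Bochner_Integration.integral_nonneg) auto
  \<comment> \<open>Replaces the third absolute moment by even moments, which are known to be
    finite.\<close>
  have bd: "\<bar>x\<^sup>2 - 1\<bar> ^ 3 \<le> x ^ 6 + 3 * x ^ 4 + 3 * x^2 + 1" for x :: real
  proof -
    have "\<bar>x\<^sup>2 - 1\<bar> ^ 3 \<le> (x\<^sup>2 + 1) ^ 3" by (intro power_mono) (auto simp: abs_if)
    also have "\<dots> = x ^ 6 + 3 * x ^ 4 + 3 * x^2 + 1"
      by (simp add: power_numeral_reduce algebra_simps)
    finally show ?thesis .
  qed
  have "cmod (char (distr M borel (\<lambda>\<omega>. (X (Suc j) \<omega>)\<^sup>2 - 1)) t - (1 - t\<^sup>2)) \<le> C / 6 * \<bar>t\<bar> ^ 3" for j t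
  proof -
    let ?Y = "\<lambda>\<omega>. (X (Suc j) \<omega>)\<^sup>2 - 1"
    have iY: "integrable M ?Y" using moment_integrable[of j 2] by simp
    have sq: "(?Y \<omega>)\<^sup>2 = X (Suc j) \<omega> ^ 4 - 2 * (X (Suc j) \<omega>)\<^sup>2 + 1" for \<omega>
      by (simp add: power_numeral_reduce algebra_simps)
    have iY2: "integrable M (\<lambda>\<omega>. (?Y \<omega>)\<^sup>2)" unfolding sq using moment_integrable by simp
    have EY: "expectation ?Y = 0"
      using moment_integrable[of j 2] second_moment[of j] by (simp add: prob_space)
    have "expectation (\<lambda>\<omega>. (?Y \<omega>)\<^sup>2) = 2" unfolding sq
      using moment_integrable[of j 2] moment_integrable[of j 4] second_moment[of j] fourth_moment[of j]
      by (simp add: prob_space)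
    then have VY: "variance ?Y = 2" by (simp add: EY)
    have "cmod (char (distr M borel ?Y) t - (1 - t\<^sup>2 * 2 / 2)) \<le>
        (t\<^sup>2 / 6) * expectation (\<lambda>x. min (6 * (?Y x)\<^sup>2) (\<bar>t\<bar> * \<bar>?Y x\<bar>^3))"
      by (rule char_approx3'[OF _ iY iY2 EY VY refl]) simp
    also have "\<dots> \<le> (t\<^sup>2 / 6) * (\<bar>t\<bar> * C)"
    proof (intro mult_left_mono)
      have "expectation (\<lambda>x. min (6 * (?Y x)\<^sup>2) (\<bar>t\<bar> * \<bar>?Y x\<bar>^3)) \<le>
          expectation (\<lambda>\<omega>. \<bar>t\<bar> * (X (Suc j) \<omega> ^ 6 + 3 * X (Suc j) \<omega> ^ 4 + 3 * (X (Suc j) \<omega>)^2 + 1))"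
      proof (rule integral_mono)
        show i2: "integrable M (\<lambda>\<omega>. \<bar>t\<bar> * (X (Suc j) \<omega> ^ 6 + 3 * X (Suc j) \<omega> ^ 4 + 3 * (X (Suc j) \<omega>)^2 + 1))"
          by (intro Bochner_Integration.integrable_mult_right intC)
        show "min (6 * (?Y x)\<^sup>2) (\<bar>t\<bar> * \<bar>?Y x\<bar>^3)
            \<le> \<bar>t\<bar> * (X (Suc j) x ^ 6 + 3 * X (Suc j) x ^ 4 + 3 * (X (Suc j) x)^2 + 1)" for x
          using mult_left_mono[OF bd[of "X (Suc j) x"], of "\<bar>t\<bar>"] by linarith
        show "integrable M (\<lambda>x. min (6 * (?Y x)\<^sup>2) (\<bar>t\<bar> * \<bar>?Y x\<bar>^3))"
          by (rule Bochner_Integration.integrable_bound[OF Bochner_Integration.integrable_mult_right[OF iY2, of 6]]) auto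
      qed
      also have "\<dots> = \<bar>t\<bar> * C" unfolding Ceq[of j] by simp
      finally show "expectation (\<lambda>x. min (6 * (?Y x)\<^sup>2) (\<bar>t\<bar> * \<bar>?Y x\<bar>^3)) \<le> \<bar>t\<bar> * C" .
    qed simp
    also have "(t\<^sup>2 / 6) * (\<bar>t\<bar> * C) = C / 6 * (\<bar>t\<bar>\<^sup>2 * \<bar>t\<bar>)" by simp
    also have "\<dots> = C / 6 * \<bar>t\<bar> ^ 3" by (simp only: power3_eq_cube power2_eq_square)
    finally show ?thesis by simp
  qed
  then show ?thesis using C0 by (intro that[of "C/6"]) auto
qed

text \<open>Independence factors the characteristic function of each partial sum. The partial sums
  converge almost surely and the integrands have modulus 1, so dominated convergence gives the
  limit.\<close>

lemma char_weighted_chi_square: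
  fixes b :: "nat \<Rightarrow> real"
  assumes b: "\<And>j. b j \<ge> 0" "summable b"
  shows "(\<lambda>N. \<Prod>j<N. char (distr M borel (\<lambda>\<omega>. (X (Suc j) \<omega>)\<^sup>2 - 1)) (b j * t)) \<longlonglongrightarrow>
     char (distr M borel (\<lambda>\<omega>. \<Sum>j. b j * ((X (Suc j) \<omega>)\<^sup>2 - 1))) t"
proof -
  let ?Y = "\<lambda>j \<omega>. (X (Suc j) \<omega>)\<^sup>2 - 1"
  let ?S = "\<lambda>\<omega>. \<Sum>j. b j * ?Y j \<omega>"
  let ?P = "\<lambda>N \<omega>. \<Sum>j<N. b j * ?Y j \<omega>"
  have "char (distr M borel (?P N)) t = (\<Prod>j<N. char (distr M borel (?Y j)) (b j * t))" for N
  proof -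
    have P: "?P N = (\<lambda>\<omega>. \<Sum>j\<in>{1..N}. b (j - 1) * ((X j \<omega>)\<^sup>2 - 1))"
      by (simp add: sum.atLeast1_atMost_eq)
    have iv: "indep_vars (\<lambda>_. borel) (\<lambda>j \<omega>. b (j - 1) * ((X j \<omega>)\<^sup>2 - 1)) {1..N}"
      by (rule indep_vars_compose2[where X=X, OF indep_vars_subset[OF indep]]) auto
    have "char (distr M borel (?P N)) t =
        (\<Prod>j\<in>{1..N}. char (distr M borel (\<lambda>\<omega>. b (j - 1) * ((X j \<omega>)\<^sup>2 - 1))) t)"
      unfolding P by (rule char_distr_sum[OF iv])
    also have "\<dots> = (\<Prod>j<N. char (distr M borel (\<lambda>\<omega>. b j * ?Y j \<omega>)) t)"
      by (simp add: prod.atLeast1_atMost_eq)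
    also have "\<dots> = (\<Prod>j<N. char (distr M borel (?Y j)) (b j * t))"
      by (intro prod.cong) (simp_all add: char_def integral_distr mult_ac)
    finally show ?thesis .
  qed
  moreover have "(\<lambda>N. char (distr M borel (?P N)) t) \<longlonglongrightarrow> char (distr M borel ?S) t"
  proof -
    have "(\<lambda>N. CLINT \<omega>|M. iexp (t * ?P N \<omega>)) \<longlonglongrightarrow> (CLINT \<omega>|M. iexp (t * ?S \<omega>))"
    proof (rule integral_dominated_convergence[where w="\<lambda>_. 1"])
      show "AE \<omega> in M. (\<lambda>N. iexp (t * ?P N \<omega>)) \<longlonglongrightarrow> iexp (t * ?S \<omega>)"
      proof (rule AE_mp[OF AE_summable_weighted_squares[OF b]], intro AE_I2 impI)
        fix \<omega> assume "summable (\<lambda>j. b j * (X (Suc j) \<omega>)\<^sup>2)"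
        from summable_diff[OF this b(2)] have "summable (\<lambda>j. b j * ?Y j \<omega>)"
          by (simp add: algebra_simps)
        then have "(\<lambda>N. ?P N \<omega>) \<longlonglongrightarrow> ?S \<omega>" by (rule summable_LIMSEQ)
        then show "(\<lambda>N. iexp (t * ?P N \<omega>)) \<longlonglongrightarrow> iexp (t * ?S \<omega>)"
          by (intro tendsto_intros)
      qed
    qed auto
    then show ?thesis by (simp add: char_def integral_distr)
  qed
  ultimately show ?thesis by simp
qed

text \<open>Lindeberg's replacement argument for characteristic functions, carried out on the partial products.\<close>

lemma weighted_chi_square_clt:
  fixes b :: "nat \<Rightarrow> nat \<Rightarrow> real"
  assumes b: "\<And>n j. b n j \<ge> 0" "\<And>n. summable (b n)"
    and b2: "\<And>n. (\<lambda>j. (b n j)\<^sup>2) sums (1/2)"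
    and max: "\<And>n j. b n j \<le> \<epsilon> n" "\<epsilon> \<longlonglongrightarrow> 0"
  shows "(\<lambda>n. prob {\<omega> \<in> space M. (\<Sum>j. b n j * ((X (Suc j) \<omega>)\<^sup>2 - 1)) \<le> z})
           \<longlonglongrightarrow> cdf std_normal_distribution z"
proof -
  let ?Y = "\<lambda>j \<omega>. (X (Suc j) \<omega>)\<^sup>2 - 1"
  let ?S = "\<lambda>n \<omega>. \<Sum>j. b n j * ?Y j \<omega>"
  obtain C where C: "C \<ge> 0"
    "\<And>j t. cmod (char (distr M borel (?Y j)) t - (1 - t\<^sup>2)) \<le> C * \<bar>t\<bar> ^ 3"
    using chi_square_char_bound by blast
  interpret Y: real_distribution "distr M borel (?Y j)" for j by (rule real_distribution_distr) simp
  have \<epsilon>0: "\<epsilon> n \<ge> 0" for n using b(1)[of n 0] max(1)[of n 0] by simp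
  have bound: "cmod (char (distr M borel (?S n)) t - complex_of_real (exp (- t\<^sup>2 / 2))) \<le>
      (C * \<bar>t\<bar> ^ 3 * \<epsilon> n + t ^ 4 * (\<epsilon> n)\<^sup>2) / 2" for n t
  proof -
    let ?B = "\<lambda>j. (C * \<bar>t\<bar> ^ 3 * \<epsilon> n + t ^ 4 * (\<epsilon> n)\<^sup>2) * (b n j)\<^sup>2"
    \<comment> \<open>Each replaced factor costs (b n j)^2 times a quantity that vanishes with
      \<open>\<epsilon> n\<close>. The total cost is thus controlled by the normalisation of the
      squares, whatever the number of factors.\<close>
    have one: "cmod (char (distr M borel (?Y j)) (b n j * t) - exp (- (b n j * t)\<^sup>2)) \<le> ?B j" for j
    proof -
      let ?u = "(b n j * t)\<^sup>2"
      have "C * \<bar>b n j * t\<bar> ^ 3 = C * \<bar>t\<bar> ^ 3 * (b n j * (b n j)\<^sup>2)"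
        using b(1)[of n j] by (simp add: abs_mult power_mult_distrib power3_eq_cube power2_eq_square)
      also have "\<dots> \<le> C * \<bar>t\<bar> ^ 3 * (\<epsilon> n * (b n j)\<^sup>2)"
        using C(1) max(1) by (intro mult_left_mono mult_right_mono) auto
      finally have 1: "C * \<bar>b n j * t\<bar> ^ 3 \<le> C * \<bar>t\<bar> ^ 3 * \<epsilon> n * (b n j)\<^sup>2" by (simp add: mult_ac)
      have "?u\<^sup>2 = t ^ 4 * ((b n j)\<^sup>2 * (b n j)\<^sup>2)"
        by (simp add: power_mult_distrib power_numeral_reduce mult_ac)
      also have "\<dots> \<le> t ^ 4 * ((\<epsilon> n)\<^sup>2 * (b n j)\<^sup>2)"
        using b(1) max(1) by (intro mult_left_mono mult_right_mono power_mono) auto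
      finally have 2: "?u\<^sup>2 \<le> t ^ 4 * (\<epsilon> n)\<^sup>2 * (b n j)\<^sup>2" by (simp add: mult_ac)
      have "cmod (complex_of_real (1 - ?u) - exp (- ?u)) = \<bar>exp (- ?u) - (1 - ?u)\<bar>"
        by (metis abs_minus_commute norm_of_real of_real_diff)
      also have "\<dots> \<le> ?u\<^sup>2" by (rule exp_minus_linear_bound) simp
      finally have 3: "cmod (complex_of_real (1 - ?u) - exp (- ?u)) \<le> ?u\<^sup>2" .
      have "cmod (char (distr M borel (?Y j)) (b n j * t) - exp (- ?u)) \<le>
         C * \<bar>b n j * t\<bar> ^ 3 + ?u\<^sup>2"
        by (rule norm_diff_triangle_le[OF C(2)[of j "b n j * t"] 3])
      then show ?thesis using 1 2 by (simp add: algebra_simps)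
    qed
    have part: "cmod ((\<Prod>j<N. char (distr M borel (?Y j)) (b n j * t)) - (\<Prod>j<N. complex_of_real (exp (- (b n j * t)\<^sup>2))))
        \<le> (C * \<bar>t\<bar> ^ 3 * \<epsilon> n + t ^ 4 * (\<epsilon> n)\<^sup>2) / 2" for N
    proof -
      have "cmod ((\<Prod>j<N. char (distr M borel (?Y j)) (b n j * t)) - (\<Prod>j<N. complex_of_real (exp (- (b n j * t)\<^sup>2))))
        \<le> (\<Sum>j<N. cmod (char (distr M borel (?Y j)) (b n j * t) - exp (- (b n j * t)\<^sup>2)))"
        \<comment> \<open>Telescoping the product is possible because all factors lie in the unit
          disc.\<close>
        by (rule norm_prod_diff) (auto simp: Y.cmod_char_le_1)
      also have "\<dots> \<le> (\<Sum>j<N. ?B j)" by (intro sum_mono one)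
      also have "\<dots> = (C * \<bar>t\<bar> ^ 3 * \<epsilon> n + t ^ 4 * (\<epsilon> n)\<^sup>2) * (\<Sum>j<N. (b n j)\<^sup>2)"
        by (simp add: sum_distrib_left)
      also have "\<dots> \<le> (C * \<bar>t\<bar> ^ 3 * \<epsilon> n + t ^ 4 * (\<epsilon> n)\<^sup>2) * (1/2)"
      proof (intro mult_left_mono)
        show "(\<Sum>j<N. (b n j)\<^sup>2) \<le> 1/2"
          using sum_le_suminf[OF sums_summable[OF b2], of "{..<N}" n] sums_unique[OF b2[of n]] by simp
      qed (use C(1) \<epsilon>0[of n] in auto)
      finally show ?thesis by simp
    qed
    \<comment> \<open>The squares of the weights sum to 1/2 because each centred square has variance
      2; the Gaussian product then tends to the standard normal characteristic function.\<close>
    have "(\<lambda>N. \<Sum>j<N. - (b n j * t)\<^sup>2) \<longlonglongrightarrow> - t\<^sup>2 / 2"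
      using sums_mult2[OF b2[of n], of "- t\<^sup>2"] by (simp add: sums_def power_mult_distrib)
    then have "(\<lambda>N. complex_of_real (exp (\<Sum>j<N. - (b n j * t)\<^sup>2))) \<longlonglongrightarrow> complex_of_real (exp (- t\<^sup>2 / 2))"
      by (intro tendsto_of_real tendsto_exp)
    then have "(\<lambda>N. \<Prod>j<N. complex_of_real (exp (- (b n j * t)\<^sup>2))) \<longlonglongrightarrow> complex_of_real (exp (- t\<^sup>2 / 2))"
      by (simp add: exp_sum)
    from tendsto_norm[OF tendsto_diff[OF char_weighted_chi_square[OF b, of n t] this]]
    show ?thesis by (rule LIMSEQ_le_const2) (use part in blast)
  qed
  have "weak_conv_m (\<lambda>n. distr M borel (?S n)) std_normal_distribution"
  proof (rule levy_continuity)
    fix t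
    have "(\<lambda>n. (C * \<bar>t\<bar> ^ 3 * \<epsilon> n + t ^ 4 * (\<epsilon> n)\<^sup>2) / 2) \<longlonglongrightarrow> (C * \<bar>t\<bar> ^ 3 * 0 + t ^ 4 * 0\<^sup>2) / 2"
      by (intro tendsto_intros max) simp_all
    then have lim: "(\<lambda>n. (C * \<bar>t\<bar> ^ 3 * \<epsilon> n + t ^ 4 * (\<epsilon> n)\<^sup>2) / 2) \<longlonglongrightarrow> 0"
      by simp
    have "(\<lambda>n. char (distr M borel (?S n)) t - complex_of_real (exp (- t\<^sup>2 / 2))) \<longlonglongrightarrow> 0"
    proof (rule Lim_null_comparison[OF always_eventually lim])
      show "\<forall>n. cmod (char (distr M borel (?S n)) t - complex_of_real (exp (- t\<^sup>2 / 2)))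
          \<le> (C * \<bar>t\<bar> ^ 3 * \<epsilon> n + t ^ 4 * (\<epsilon> n)\<^sup>2) / 2"
        using bound by blast
    qed
    then show "(\<lambda>n. char (distr M borel (?S n)) t) \<longlonglongrightarrow> char std_normal_distribution t"
      by (simp add: char_std_normal_distribution LIM_zero_iff)
  qed (auto intro!: real_distribution_distr real_dist_normal_dist)
  then have "(\<lambda>n. cdf (distr M borel (?S n)) z) \<longlonglongrightarrow> cdf std_normal_distribution z"
    by (simp add: weak_conv_m_def weak_conv_def std_normal_cdf_isCont)
  moreover have "cdf (distr M borel (?S n)) z = prob {\<omega> \<in> space M. ?S n \<omega> \<le> z}" for n
    unfolding cdf_def2 by (subst measure_distr) (auto intro!: arg_cong[where f=prob])
  ultimately show ?thesis by simp
qed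

end

subsection \<open>Orthonormal bases, balls and projections\<close>

lemma L2D:
  assumes "f \<in> L2"
  shows "f \<in> borel_measurable (lebesgue_on {0<..<1})" "integrable (lebesgue_on {0<..<1}) (\<lambda>t. (f t)\<^sup>2)"
  using assms by (auto simp: L2_def)

lemma abs_mult_le_sum_squares: "\<bar>x * y\<bar> \<le> x\<^sup>2 + y\<^sup>2" for x y :: real
proof -
  have "2 * (\<bar>x\<bar> * \<bar>y\<bar>) \<le> x\<^sup>2 + y\<^sup>2"
    using zero_le_power2[of "\<bar>x\<bar> - \<bar>y\<bar>"] by (simp add: power2_diff)
  moreover have "0 \<le> \<bar>x\<bar> * \<bar>y\<bar>" by simp
  ultimately show ?thesis unfolding abs_mult by linarith
qed

lemma integrable_mult_L2:
  assumes "f \<in> L2" "g \<in> L2"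
  shows "integrable (lebesgue_on {0<..<1}) (\<lambda>t. f t * g t)"
proof (rule Bochner_Integration.integrable_bound)
  show "integrable (lebesgue_on {0<..<1}) (\<lambda>t. (f t)\<^sup>2 + (g t)\<^sup>2)"
    using assms by (intro Bochner_Integration.integrable_add L2D)
  show "AE t in lebesgue_on {0<..<1}. norm (f t * g t) \<le> norm ((f t)\<^sup>2 + (g t)\<^sup>2)"
    using abs_mult_le_sum_squares by simp
qed (use assms L2D(1) in measurable)

lemma L2_add: assumes "f \<in> L2" "g \<in> L2" shows "(\<lambda>t. f t + g t) \<in> L2"
proof -
  have "integrable (lebesgue_on {0<..<1}) (\<lambda>t. (f t)\<^sup>2 + 2 * (f t * g t) + (g t)\<^sup>2)"
    using assms by (intro Bochner_Integration.integrable_add Bochner_Integration.integrable_mult_right L2D integrable_mult_L2)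
  then show ?thesis using L2D(1)[OF assms(1)] L2D(1)[OF assms(2)]
    unfolding L2_def by (simp add: power2_sum algebra_simps)
qed

lemma L2_scale: assumes "f \<in> L2" shows "(\<lambda>t. a * f t) \<in> L2"
  using assms unfolding L2_def
  by (auto simp: power_mult_distrib intro!: borel_measurable_times borel_measurable_const)

lemma L2_diff: assumes "f \<in> L2" "g \<in> L2" shows "(\<lambda>t. f t - g t) \<in> L2"
  using L2_add[OF assms(1) L2_scale[OF assms(2), of "-1"]] by simp

lemma L2_zero: "(\<lambda>t. 0) \<in> L2" by (simp add: L2_def)

lemma L2_sum: assumes "\<And>j. j \<in> A \<Longrightarrow> f j \<in> L2" shows "(\<lambda>t. \<Sum>j\<in>A. f j t) \<in> L2"
  using assms by (induction A rule: infinite_finite_induct) (auto intro: L2_zero L2_add)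

lemma ip_commute: "ip f g = ip g f" by (simp add: ip_def mult.commute)

lemma ip_diff_left: "f \<in> L2 \<Longrightarrow> g \<in> L2 \<Longrightarrow> h \<in> L2 \<Longrightarrow> ip (\<lambda>t. f t - g t) h = ip f h - ip g h"
  unfolding ip_def using integrable_mult_L2 by (simp add: left_diff_distrib)

lemma ip_scale_left: "ip (\<lambda>t. a * f t) h = a * ip f h"
  unfolding ip_def by (simp add: mult.assoc)

lemma ip_sum_left:
  assumes "\<And>j. j \<in> A \<Longrightarrow> f j \<in> L2" "h \<in> L2"
  shows "ip (\<lambda>t. \<Sum>j\<in>A. f j t) h = (\<Sum>j\<in>A. ip (f j) h)"
  unfolding ip_def sum_distrib_right using assms
  by (intro Bochner_Integration.integral_sum integrable_mult_L2)

lemma ip_self_nonneg: "ip f f \<ge> 0"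
  unfolding ip_def by (intro Bochner_Integration.integral_nonneg) simp

lemma l2norm_sq: "(l2norm f)\<^sup>2 = ip f f" by (simp add: l2norm_def ip_self_nonneg)

lemma l2norm_nonneg: "l2norm f \<ge> 0" by (simp add: l2norm_def ip_self_nonneg)

lemma ip_zero_left: "ip (\<lambda>t. 0) g = 0" by (simp add: ip_def)

locale L2_basis =
  fixes \<phi> :: "nat \<Rightarrow> real \<Rightarrow> real"
  assumes basis: "orthonormal_basis \<phi>"
begin

lemma phi_L2: "j \<ge> 1 \<Longrightarrow> \<phi> j \<in> L2"
  and ip_phi: "i \<ge> 1 \<Longrightarrow> j \<ge> 1 \<Longrightarrow> ip (\<phi> i) (\<phi> j) = (if i = j then 1 else 0)"
  using basis by (auto simp: orthonormal_basis_def orthonormal_def)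

definition comb :: "(nat \<Rightarrow> real) \<Rightarrow> nat \<Rightarrow> real \<Rightarrow> real" where
  "comb a N = (\<lambda>t. \<Sum>j=1..N. a j * \<phi> j t)"

lemma comb_L2: "comb a N \<in> L2"
  unfolding comb_def by (intro L2_sum L2_scale phi_L2) auto

lemma ip_comb_left: "h \<in> L2 \<Longrightarrow> ip (comb a N) h = (\<Sum>j=1..N. a j * ip (\<phi> j) h)"
  unfolding comb_def
  by (subst ip_sum_left) (auto intro!: L2_scale phi_L2[simplified] simp: ip_scale_left)

lemma ip_comb_phi: "i \<ge> 1 \<Longrightarrow> ip (comb a N) (\<phi> i) = (if i \<le> N then a i else 0)"
  by (simp add: ip_comb_left phi_L2 ip_phi if_distrib cong: if_cong)

text \<open>Completing the square in the coefficients. Both the Parseval identity and the distance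
  to the span are read off from it: only the last sum depends on \<open>a\<close>.\<close>

lemma ip_diff_comb_self:
  assumes "f \<in> L2"
  shows "ip (\<lambda>t. f t - comb a N t) (\<lambda>t. f t - comb a N t) =
         ip f f - (\<Sum>j=1..N. (ip f (\<phi> j))\<^sup>2) + (\<Sum>j=1..N. (ip f (\<phi> j) - a j)\<^sup>2)"
proof -
  note L = assms comb_L2 L2_diff[OF assms comb_L2]
  have "ip (\<lambda>t. f t - comb a N t) (\<lambda>t. f t - comb a N t) =
        ip f f - 2 * ip (comb a N) f + ip (comb a N) (comb a N)"
    using L by (simp add: ip_diff_left ip_commute[of f "\<lambda>t. f t - comb a N t"] ip_commute[of "comb a N" "\<lambda>t. f t - comb a N t"] ip_commute[of f "comb a N"])
  also have "ip (comb a N) (comb a N) = (\<Sum>j=1..N. a j * a j)"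
    by (simp add: ip_comb_left[OF comb_L2] ip_commute[of "\<phi> j" for j] ip_comb_phi)
  also have "ip (comb a N) f = (\<Sum>j=1..N. a j * ip f (\<phi> j))"
    by (simp add: ip_comb_left[OF assms] ip_commute[of "\<phi> j" for j])
  finally show ?thesis
    by (simp add: power2_eq_square algebra_simps sum_subtractf sum.distrib sum_distrib_left)
qed

lemma parseval:
  assumes "f \<in> L2" shows "(\<lambda>j. (ip f (\<phi> (Suc j)))\<^sup>2) sums ip f f"
proof -
  have "(\<lambda>N. l2norm (\<lambda>t. f t - comb (\<lambda>j. ip f (\<phi> j)) N t)) \<longlonglongrightarrow> 0"
    using basis assms by (simp add: orthonormal_basis_def comb_def)
  then have "(\<lambda>N. (l2norm (\<lambda>t. f t - comb (\<lambda>j. ip f (\<phi> j)) N t))\<^sup>2) \<longlonglongrightarrow> 0\<^sup>2"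
    by (intro tendsto_power)
  then have "(\<lambda>N. ip f f - (\<Sum>j=1..N. (ip f (\<phi> j))\<^sup>2)) \<longlonglongrightarrow> 0"
    by (simp add: l2norm_sq ip_diff_comb_self[OF assms])
  from tendsto_diff[OF tendsto_const[of "ip f f"] this]
  show ?thesis by (simp add: sums_def sum.atLeast1_atMost_eq)
qed

section \<open>Tails of the coefficients and the balls\<close>

definition tail :: "(real \<Rightarrow> real) \<Rightarrow> nat \<Rightarrow> real" where
  "tail f i = ip f f - (\<Sum>j=1..i. (ip f (\<phi> j))\<^sup>2)"

lemma tail_sums:
  assumes "f \<in> L2" shows "(\<lambda>j. if i < Suc j then (ip f (\<phi> (Suc j)))\<^sup>2 else 0) sums tail f i"
proof -
  have "(\<lambda>j. if j \<in> {..<i} then (ip f (\<phi> (Suc j)))\<^sup>2 else 0) sums (\<Sum>j<i. (ip f (\<phi> (Suc j)))\<^sup>2)"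
    by (rule sums_If_finite_set) simp
  from sums_diff[OF parseval[OF assms] this]
  have "(\<lambda>j. (ip f (\<phi> (Suc j)))\<^sup>2 - (if j < i then (ip f (\<phi> (Suc j)))\<^sup>2 else 0)) sums tail f i"
    by (simp add: tail_def sum.atLeast1_atMost_eq)
  moreover have "(\<lambda>j. (ip f (\<phi> (Suc j)))\<^sup>2 - (if j < i then (ip f (\<phi> (Suc j)))\<^sup>2 else 0)) =
      (\<lambda>j. if i < Suc j then (ip f (\<phi> (Suc j)))\<^sup>2 else 0)" by auto
  ultimately show ?thesis by simp
qed

lemma tail_nonneg: assumes "f \<in> L2" shows "tail f i \<ge> 0"
  by (rule sums_le[OF _ sums_zero tail_sums[OF assms]]) simp

lemma tail_mono: "i \<le> j \<Longrightarrow> tail f j \<le> tail f i"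
  unfolding tail_def by (auto intro!: sum_mono2)

lemma tail_tendsto: assumes "f \<in> L2" shows "tail f \<longlonglongrightarrow> 0"
  using tendsto_diff[OF tendsto_const[of "ip f f"] parseval[OF assms, unfolded sums_def]]
  by (simp add: tail_def[abs_def] sum.atLeast1_atMost_eq)

lemma tail_real_index:
  assumes "f \<in> L2" "l > 0"
  shows "(\<Sum>j. if l < real (Suc j) then (ip f (\<phi> (Suc j)))\<^sup>2 else 0) = tail f (nat \<lfloor>l\<rfloor>)"
proof -
  have "(l < real (Suc j)) = (nat \<lfloor>l\<rfloor> < Suc j)" for j using assms(2) by linarith
  then show ?thesis using sums_unique[OF tail_sums[OF assms(1), of "nat \<lfloor>l\<rfloor>"]] by simp
qed

lemma besov_ball_iff:
  "f \<in> besov_ball \<phi> s P \<longleftrightarrow> f \<in> L2 \<and> (\<forall>l>0. l powr (2 * s) * tail f (nat \<lfloor>l\<rfloor>) \<le> P)"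
  unfolding besov_ball_def mem_Collect_eq
  by (intro conj_cong all_cong1 imp_cong refl) (simp only: tail_real_index)

text \<open>For l in (i, i+1) the tail is constant while l^(2s) increases, so the supremum there is
  the limit at i+1. This explains \<open>Suc i\<close> as the base of the power next to
  \<open>tail f i\<close>.\<close>

lemma besov_ball_iff_tail:
  assumes "s > 0"
  shows "f \<in> besov_ball \<phi> s P \<longleftrightarrow> f \<in> L2 \<and> (\<forall>i. real (Suc i) powr (2 * s) * tail f i \<le> P)"
proof (intro iffI conjI allI; (elim conjE)?)
  fix i assume f: "f \<in> besov_ball \<phi> s P"
  have "((\<lambda>l. l powr (2 * s) * tail f i) \<longlongrightarrow> real (Suc i) powr (2 * s) * tail f i) (at_left (real (Suc i)))"
    by (intro tendsto_intros) auto
  moreover have "\<forall>\<^sub>F l in at_left (real (Suc i)). l powr (2 * s) * tail f i \<le> P"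
    unfolding eventually_at_left_field
  proof (intro exI[of _ "real i"] conjI allI impI)
    fix l assume l: "real i < l" "l < real (Suc i)"
    then have "nat \<lfloor>l\<rfloor> = i" "l > 0" by linarith+
    then show "l powr (2 * s) * tail f i \<le> P" using f by (auto simp: besov_ball_iff)
  qed auto
  ultimately show "real (Suc i) powr (2 * s) * tail f i \<le> P"
    by (rule tendsto_upperbound) simp
next
  assume f: "f \<in> L2" "\<forall>i. real (Suc i) powr (2 * s) * tail f i \<le> P"
  show "f \<in> besov_ball \<phi> s P" unfolding besov_ball_iff
  proof (intro conjI allI impI f(1))
    fix l :: real assume l: "l > 0"
    then have "l \<le> real (Suc (nat \<lfloor>l\<rfloor>))" by linarith
    then have "l powr (2 * s) \<le> real (Suc (nat \<lfloor>l\<rfloor>)) powr (2 * s)"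
      using l assms by (intro powr_mono2) auto
    then show "l powr (2 * s) * tail f (nat \<lfloor>l\<rfloor>) \<le> P"
      using f tail_nonneg[OF f(1)] by (meson mult_right_mono order_trans)
  qed
qed (simp add: besov_ball_def)

section \<open>Greedy elements and orthogonal projections\<close>

lemma tail_scaled_phi:
  assumes "i \<ge> 1" shows "tail (\<lambda>t. a * \<phi> i t) j = (if j < i then a\<^sup>2 else 0)"
proof -
  have "ip (\<lambda>t. a * \<phi> i t) (\<phi> k) = (if k = i then a else 0)" if "k \<ge> 1" for k
    using assms that by (simp add: ip_scale_left ip_phi)
  moreover have "ip (\<lambda>t. a * \<phi> i t) (\<lambda>t. a * \<phi> i t) = a\<^sup>2"
    using assms by (subst ip_scale_left, subst ip_commute, subst ip_scale_left)
       (simp add: ip_phi power2_eq_square)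
  moreover have "(\<Sum>k=1..j. (if k = i then a else 0)\<^sup>2) = (if i \<le> j then a\<^sup>2 else 0)"
    using assms by (simp add: if_distrib[of "\<lambda>x. x\<^sup>2"] cong: if_cong)
  ultimately show ?thesis by (simp add: tail_def)
qed

lemma span_first_scaled_phi:
  assumes "\<And>i. i \<ge> 1 \<Longrightarrow> a i \<noteq> 0"
  shows "span_first (\<lambda>i t. a i * \<phi> i t) m = {comb c m | c. True}"
proof (intro set_eqI iffI)
  fix x assume "x \<in> span_first (\<lambda>i t. a i * \<phi> i t) m"
  then obtain c where "x = (\<lambda>t. \<Sum>j=1..m. c j * (a j * \<phi> j t))" by (auto simp: span_first_def)
  then have "x = comb (\<lambda>j. c j * a j) m" by (simp add: comb_def mult.assoc)
  then show "x \<in> {comb c m | c. True}" by blast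
next
  fix x assume "x \<in> {comb c m | c. True}"
  then obtain c where "x = comb c m" by blast
  then have "x = (\<lambda>t. \<Sum>j=1..m. (c j / a j) * (a j * \<phi> j t))"
    using assms[simplified] by (auto simp: comb_def intro!: sum.cong)
  then show "x \<in> span_first (\<lambda>i t. a i * \<phi> i t) m"
    unfolding span_first_def by (auto intro!: exI[of _ "\<lambda>j. c j / a j"])
qed

text \<open>The infimum is attained at the Fourier coefficients, where the sum of squares added to
  the tail vanishes.\<close>

lemma l2dist_comb:
  assumes "f \<in> L2" shows "l2dist f {comb c m | c. True} = sqrt (tail f m)"
proof -
  have n: "l2norm (\<lambda>t. f t - comb c m t) = sqrt (tail f m + (\<Sum>j=1..m. (ip f (\<phi> j) - c j)\<^sup>2))" for c
    using assms by (simp add: l2norm_def ip_diff_comb_self tail_def)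
  show ?thesis unfolding l2dist_def
  proof (rule antisym)
    have "(INF h\<in>{comb c m | c. True}. l2norm (\<lambda>t. f t - h t)) \<le> l2norm (\<lambda>t. f t - comb (\<lambda>j. ip f (\<phi> j)) m t)"
      by (rule cINF_lower) (auto intro!: bdd_belowI[of _ 0] l2norm_nonneg)
    then show "(INF h\<in>{comb c m | c. True}. l2norm (\<lambda>t. f t - h t)) \<le> sqrt (tail f m)"
      by (simp add: n)
    show "sqrt (tail f m) \<le> (INF h\<in>{comb c m | c. True}. l2norm (\<lambda>t. f t - h t))"
      by (rule cINF_greatest) (auto simp: n sum_nonneg)
  qed
qed

text \<open>For g in the ball, the condition for l just below i bounds the squared distance to the
  span of the first i - 1 basis functions by P i^(-2s). The multiple of \<open>\<phi> i\<close> with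
  exactly this squared norm attains the bound, and it stays in the ball because its tail vanishes
  from index i on.\<close>

lemma greedy_sequence_phi:
  assumes s: "s > 0" and P: "P > 0"
  shows "greedy_sequence (besov_ball \<phi> s P) (\<lambda>i t. (sqrt P * real i powr (- s)) * \<phi> i t)"
proof -
  let ?a = "\<lambda>i. sqrt P * real i powr (- s)"
  have a0: "?a i \<noteq> 0" if "i \<ge> 1" for i using P that by simp
  have a2: "(?a i)\<^sup>2 = P * real i powr (- (2 * s))" for i
    using P by (simp add: power_mult_distrib power2_eq_square[of "_ powr _"] flip: powr_add)
  show ?thesis unfolding greedy_sequence_def
  proof (intro allI impI conjI ballI)
    fix i :: nat assume i: "i \<ge> 1"
    show U: "(\<lambda>t. ?a i * \<phi> i t) \<in> besov_ball \<phi> s P"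
      unfolding besov_ball_iff_tail[OF s]
    proof (intro conjI allI)
      show "(\<lambda>t. ?a i * \<phi> i t) \<in> L2" using i by (intro L2_scale phi_L2)
      fix j
      show "real (Suc j) powr (2 * s) * tail (\<lambda>t. ?a i * \<phi> i t) j \<le> P"
      proof (cases "j < i")
        case True
        then have "real (Suc j) powr (2 * s) * real i powr (- (2 * s)) \<le> real i powr (2 * s) * real i powr (- (2 * s))"
          using s by (intro mult_right_mono powr_mono2) auto
        also have "\<dots> = 1" using i by (simp add: powr_minus field_simps)
        finally have "P * (real (Suc j) powr (2 * s) * real i powr (- (2 * s))) \<le> P * 1"
          using P by (intro mult_left_mono) auto
        then show ?thesis using True by (simp only: tail_scaled_phi[OF i] a2) (simp add: mult_ac)
      qed (use P in \<open>simp add: tail_scaled_phi[OF i]\<close>)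
    qed
    fix g assume g: "g \<in> besov_ball \<phi> s P"
    have gL: "g \<in> L2" using g by (simp add: besov_ball_def)
    have "real (Suc (i - 1)) powr (2 * s) * tail g (i - 1) \<le> P"
      using g besov_ball_iff_tail[OF s] by blast
    then have "tail g (i - 1) \<le> P * real i powr (- (2 * s))"
      using i by (simp add: powr_minus field_simps)
    then have "sqrt (tail g (i - 1)) \<le> sqrt (tail (\<lambda>t. ?a i * \<phi> i t) (i - 1))"
      using i by (subst tail_scaled_phi[OF i]) (simp only: a2, simp)
    moreover have "span_first (\<lambda>i t. ?a i * \<phi> i t) (i - 1) = {comb c (i - 1) | c. True}"
      by (rule span_first_scaled_phi) (rule a0)
    moreover have "(\<lambda>t. ?a i * \<phi> i t) \<in> L2" using i by (intro L2_scale phi_L2)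
    ultimately show "l2dist g (span_first (\<lambda>i t. ?a i * \<phi> i t) (i - 1)) \<le>
      l2dist (\<lambda>t. ?a i * \<phi> i t) (span_first (\<lambda>i t. ?a i * \<phi> i t) (i - 1))"
      using l2dist_comb gL by presburger
  qed
qed

text \<open>The choice is unique even though functions are not identified almost everywhere: a
  candidate is a combination of the first m basis functions, orthogonality of its residual to each
  \<open>\<phi> j\<close> fixes its coefficients, and equal coefficients give the same function at
  every point.\<close>

lemma orth_proj_comb:
  assumes "f \<in> L2"
  shows "orth_proj {comb c m | c. True} f = comb (\<lambda>j. ip f (\<phi> j)) m"
  unfolding orth_proj_def
proof (rule some_equality)
  show "comb (\<lambda>j. ip f (\<phi> j)) m \<in> {comb c m | c. True} \<and>
    (\<forall>h\<in>{comb c m | c. True}. ip (\<lambda>t. f t - comb (\<lambda>j. ip f (\<phi> j)) m t) h = 0)"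
  proof (intro conjI ballI)
    fix h assume "h \<in> {comb c m | c. True}"
    then obtain c where h: "h = comb c m" by blast
    have "ip (\<phi> j) (\<lambda>t. f t - comb (\<lambda>j. ip f (\<phi> j)) m t) = 0" if "j \<in> {1..m}" for j
      using assms that by (subst ip_commute) (simp add: ip_diff_left comb_L2 phi_L2 ip_comb_phi)
    then show "ip (\<lambda>t. f t - comb (\<lambda>j. ip f (\<phi> j)) m t) h = 0"
      unfolding h by (subst ip_commute) (simp add: ip_comb_left L2_diff comb_L2 assms)
  qed blast
next
  fix p assume p: "p \<in> {comb c m | c. True} \<and> (\<forall>h\<in>{comb c m | c. True}. ip (\<lambda>t. f t - p t) h = 0)"
  then obtain c where c: "p = comb c m" by blast
  have "ip f (\<phi> j) = c j" if j: "j \<in> {1..m}" for j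
  proof -
    have "\<phi> j = comb (\<lambda>k. if k = j then 1 else 0) m"
      using j by (auto simp: comb_def if_distrib[of "\<lambda>x. x * _"] cong: if_cong)
    then have "ip (\<lambda>t. f t - p t) (\<phi> j) = 0" using p by blast
    then show ?thesis using j assms by (simp add: c ip_diff_left comb_L2 phi_L2 ip_comb_phi)
  qed
  then show "p = comb (\<lambda>j. ip f (\<phi> j)) m" unfolding c by (auto simp: comb_def intro!: sum.cong)
qed

lemma
  fixes m :: nat
  assumes "f \<in> L2" "\<And>i. i \<ge> 1 \<Longrightarrow> a i \<noteq> 0"
  defines "g \<equiv> f_tilde (\<lambda>i t. a i * \<phi> i t) f m"
  shows f_tilde_L2: "g \<in> L2"
    and ip_f_tilde: "j \<ge> 1 \<Longrightarrow> ip g (\<phi> j) = (if m < j then ip f (\<phi> j) else 0)"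
    and l2norm_f_tilde: "l2norm g = sqrt (tail f m)"
proof -
  have g: "g = (\<lambda>t. f t - comb (\<lambda>j. ip f (\<phi> j)) m t)"
    unfolding g_def f_tilde_def by (simp only: span_first_scaled_phi[of a, OF assms(2)] orth_proj_comb[OF assms(1)])
  show "g \<in> L2" unfolding g by (intro L2_diff assms comb_L2)
  show "ip g (\<phi> j) = (if m < j then ip f (\<phi> j) else 0)" if "j \<ge> 1"
    using that assms(1) by (simp add: g ip_diff_left comb_L2 phi_L2 ip_comb_phi)
  show "l2norm g = sqrt (tail f m)"
    unfolding g l2norm_def tail_def ip_diff_comb_self[OF assms(1)] by simp
qed

end

subsection \<open>The test statistic as a shifted weighted sum of squares\<close>

locale white_noise_detection =
  fixes M :: "'a measure"
    and w :: "(real \<Rightarrow> real) \<Rightarrow> 'a \<Rightarrow> real"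
    and \<sigma> r s :: real
    and \<phi> :: "nat \<Rightarrow> real \<Rightarrow> real"
    and \<kappa> :: "nat \<Rightarrow> nat \<Rightarrow> real"
  assumes noise: "white_noise M w"
    and sigma_pos: "\<sigma> > 0"
    and phi_basis: "orthonormal_basis \<phi>"
    and summable_kappa: "n \<ge> 1 \<Longrightarrow> summable (\<lambda>j. (\<kappa> (Suc j) n)\<^sup>2)"
    and A1: "assumption_A1 \<kappa>"
    and A2: "assumption_A2 \<kappa> \<sigma>"
    and A4: "assumption_A4 \<kappa>"
    and A5: "assumption_A5 \<kappa> \<sigma>"
    and r_pos: "0 < r" and r_less: "r < 1/2"
    and s_eq: "s = r / (2 - 4 * r)"
    and k_bounds: "\<exists>c>0. \<exists>C\<ge>c. \<forall>n\<ge>1. c * real n powr (2 - 4 * r) \<le> real (k_index \<kappa> n) \<and>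
                          real (k_index \<kappa> n) \<le> C * real n powr (2 - 4 * r)"
begin

sublocale L2_basis \<phi> by unfold_locales (rule phi_basis)

sublocale iid_std_normal M "\<lambda>j. w (\<phi> j)"
proof -
  have o: "orthonormal \<phi>" using phi_basis by (simp add: orthonormal_basis_def)
  interpret prob_space M using noise by (simp add: white_noise_def)
  show "iid_std_normal M (\<lambda>j. w (\<phi> j))"
    using noise o by unfold_locales (auto simp: white_noise_def)
qed

lemma s_pos: "s > 0" using r_pos r_less by (simp add: s_eq)

lemma kappa_mono:
  assumes "n \<ge> 1" "i \<ge> 1" "i \<le> j" shows "(\<kappa> j n)\<^sup>2 \<le> (\<kappa> i n)\<^sup>2"
  using assms(3)
proof (induction j rule: dec_induct)
  case (step j)
  then have "(\<kappa> (j + 1) n)\<^sup>2 \<le> (\<kappa> j n)\<^sup>2"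
    using A1 assms(1,2) by (auto simp: assumption_A1_def)
  then show ?case using step.IH by simp
qed simp

text \<open>Under the hypothesis the statistic has standard deviation \<open>scale n\<close>;
  \<open>sd n\<close> is that number in units of \<sigma>^4 / n^2. Here \<open>b n j\<close> belongs
  to the basis function with index \<open>Suc j\<close>, which causes the index shifts by one
  below.\<close>

definition sd :: "nat \<Rightarrow> real" where
  "sd n = sqrt (2 * A_seq \<kappa> \<sigma> n)"

definition b :: "nat \<Rightarrow> nat \<Rightarrow> real" where
  "b n j = real n * (\<kappa> (Suc j) n)\<^sup>2 / (\<sigma>\<^sup>2 * sd n)"

definition scale :: "nat \<Rightarrow> real" where
  "scale n = sd n * \<sigma> ^ 4 / (real n)\<^sup>2"

definition S :: "nat \<Rightarrow> 'a \<Rightarrow> real" where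
  "S n \<omega> = (\<Sum>j. b n j * ((w (\<phi> (Suc j)) \<omega>)\<^sup>2 - 1))"

text \<open>This and the next two definitions come from expanding (\<theta>_j + \<sigma> n^(-1/2)
  \<xi>_j)^2 in the statistic and dividing by \<open>scale n\<close>: the terms in \<theta>_j^2 give
  \<open>shift\<close>, the mixed terms give \<open>cross\<close>.\<close>

definition shift :: "nat \<Rightarrow> (real \<Rightarrow> real) \<Rightarrow> real" where
  "shift n g = (\<Sum>j. real n / \<sigma>\<^sup>2 * b n j * (ip g (\<phi> (Suc j)))\<^sup>2)"

definition cross_coeff :: "nat \<Rightarrow> (real \<Rightarrow> real) \<Rightarrow> nat \<Rightarrow> real" where
  "cross_coeff n g j = 2 * sqrt (real n) / \<sigma> * b n j * ip g (\<phi> (Suc j))"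

definition cross :: "nat \<Rightarrow> (real \<Rightarrow> real) \<Rightarrow> 'a \<Rightarrow> real" where
  "cross n g \<omega> = (\<Sum>j. cross_coeff n g j * w (\<phi> (Suc j)) \<omega>)"

lemma measurable_S [measurable]: "S n \<in> borel_measurable M"
  unfolding S_def[abs_def] by measurable

lemma measurable_cross [measurable]: "cross n g \<in> borel_measurable M"
  unfolding cross_def[abs_def] by measurable

lemma measurable_test_stat [measurable]:
  "(\<lambda>\<omega>. test_stat \<kappa> \<sigma> \<phi> n (observe w \<sigma> n g \<omega>)) \<in> borel_measurable M"
  unfolding test_stat_def observe_def by measurable

lemma A_seq_pos: "n \<ge> 1 \<Longrightarrow> A_seq \<kappa> \<sigma> n > 0"
  using A2 less_trans unfolding assumption_A2_def by blast

lemma sd_pos: "n \<ge> 1 \<Longrightarrow> sd n > 0"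
  using A_seq_pos by (simp add: sd_def)

lemma scale_pos: "n \<ge> 1 \<Longrightarrow> scale n > 0"
  using sd_pos[of n] sigma_pos by (simp add: scale_def)

lemma b_nonneg: "n \<ge> 1 \<Longrightarrow> b n j \<ge> 0"
  using sd_pos[of n] by (simp add: b_def)

lemma b_mono: "n \<ge> 1 \<Longrightarrow> i \<le> j \<Longrightarrow> b n j \<le> b n i"
  unfolding b_def using sd_pos[of n]
  by (intro divide_right_mono mult_left_mono kappa_mono) auto

lemma summable_b: "n \<ge> 1 \<Longrightarrow> summable (b n)"
  unfolding b_def[abs_def] by (intro summable_divide summable_mult summable_kappa)

lemma summable_kappa4: assumes "n \<ge> 1" shows "summable (\<lambda>j. (\<kappa> (Suc j) n) ^ 4)"
proof (rule summable_comparison_test'[where N=0])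
  show "summable (\<lambda>j. (\<kappa> 1 n)\<^sup>2 * (\<kappa> (Suc j) n)\<^sup>2)"
    by (intro summable_mult summable_kappa assms)
  fix j
  have "norm (\<kappa> (Suc j) n ^ 4) = (\<kappa> (Suc j) n)\<^sup>2 * (\<kappa> (Suc j) n)\<^sup>2"
    by (simp flip: power_add)
  also have "\<dots> \<le> (\<kappa> 1 n)\<^sup>2 * (\<kappa> (Suc j) n)\<^sup>2"
    using assms by (intro mult_right_mono kappa_mono) auto
  finally show "norm (\<kappa> (Suc j) n ^ 4) \<le> (\<kappa> 1 n)\<^sup>2 * (\<kappa> (Suc j) n)\<^sup>2" .
qed

lemma sum_kappa4_eq: "n \<ge> 1 \<Longrightarrow> (\<Sum>j. (\<kappa> (Suc j) n) ^ 4) = A_seq \<kappa> \<sigma> n * \<sigma> ^ 4 / (real n)\<^sup>2"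
  using sigma_pos by (simp add: A_seq_def)

lemma b_sq: "n \<ge> 1 \<Longrightarrow> (b n j)\<^sup>2 = (real n)\<^sup>2 / (\<sigma> ^ 4 * (2 * A_seq \<kappa> \<sigma> n)) * (\<kappa> (Suc j) n) ^ 4"
proof -
  assume n: "n \<ge> 1"
  have sq: "(x\<^sup>2)\<^sup>2 = x ^ 4" for x :: real by (simp flip: power_mult)
  have "(sd n)\<^sup>2 = 2 * A_seq \<kappa> \<sigma> n" using A_seq_pos[OF n] by (simp add: sd_def)
  then show ?thesis unfolding b_def power_divide power_mult_distrib sq by simp
qed

lemma b_sq_sums: assumes "n \<ge> 1" shows "(\<lambda>j. (b n j)\<^sup>2) sums (1/2)"
  using sums_mult[OF summable_sums[OF summable_kappa4[OF assms]],
      of "(real n)\<^sup>2 / (\<sigma> ^ 4 * (2 * A_seq \<kappa> \<sigma> n))"]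
    assms A_seq_pos[OF assms] sigma_pos
  by (simp add: b_sq sum_kappa4_eq)

text \<open>The weights decrease, so the first i + 1 squares are all at least (b n i)^2, and
  together they are at most 1/2.\<close>

lemma b_le_inverse_sqrt:
  assumes "n \<ge> 1" shows "b n i \<le> 1 / sqrt (2 * real (Suc i))"
proof -
  have "real (Suc i) * (b n i)\<^sup>2 = (\<Sum>j<Suc i. (b n i)\<^sup>2)" by simp
  also have "\<dots> \<le> (\<Sum>j<Suc i. (b n j)\<^sup>2)"
    using assms by (intro sum_mono power_mono b_mono b_nonneg) auto
  also have "\<dots> \<le> 1/2"
    using sum_le_suminf[OF sums_summable[OF b_sq_sums[OF assms]], of "{..<Suc i}"]
      sums_unique[OF b_sq_sums[OF assms]] by simp
  finally have "(b n i)\<^sup>2 \<le> 1 / (2 * real (Suc i))" by (simp add: field_simps)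
  then have "b n i \<le> sqrt (1 / (2 * real (Suc i)))" by (rule real_le_rsqrt)
  then show ?thesis by (simp add: real_sqrt_divide)
qed

lemma summable_coeff: "g \<in> L2 \<Longrightarrow> summable (\<lambda>j. (ip g (\<phi> (Suc j)))\<^sup>2)"
  using parseval sums_summable by blast

lemma summable_b_coeff:
  assumes "n \<ge> 1" "g \<in> L2" shows "summable (\<lambda>j. b n j * (ip g (\<phi> (Suc j)))\<^sup>2)"
proof (rule summable_comparison_test'[where N=0])
  show "summable (\<lambda>j. b n 0 * (ip g (\<phi> (Suc j)))\<^sup>2)" by (intro summable_mult summable_coeff assms)
  show "norm (b n j * (ip g (\<phi> (Suc j)))\<^sup>2) \<le> b n 0 * (ip g (\<phi> (Suc j)))\<^sup>2" for j
    using b_nonneg[OF assms(1), of j] b_mono[OF assms(1), of 0 j] by (simp add: abs_mult mult_right_mono)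
qed

lemma summable_shift:
  assumes "n \<ge> 1" "g \<in> L2" shows "summable (\<lambda>j. real n / \<sigma>\<^sup>2 * b n j * (ip g (\<phi> (Suc j)))\<^sup>2)"
  using summable_mult[OF summable_b_coeff[OF assms], of "real n / \<sigma>\<^sup>2"] by (simp add: mult.assoc)

lemma shift_nonneg: "n \<ge> 1 \<Longrightarrow> g \<in> L2 \<Longrightarrow> shift n g \<ge> 0"
  unfolding shift_def 
  by (intro suminf_nonneg summable_shift mult_nonneg_nonneg divide_nonneg_nonneg b_nonneg) auto

text \<open>One of the two factors \<open>b n j\<close> in the squared coefficient is replaced by
  the largest weight; the other is kept, which reproduces the shift of the same g.\<close>

lemma
  assumes "n \<ge> 1" "g \<in> L2"
  shows summable_cross_coeff_sq: "summable (\<lambda>j. (cross_coeff n g j)\<^sup>2)"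
    and suminf_cross_coeff_sq_le: "(\<Sum>j. (cross_coeff n g j)\<^sup>2) \<le> 4 * b n 0 * shift n g"
proof -
  let ?f = "\<lambda>j. 4 * b n 0 * (real n / \<sigma>\<^sup>2 * b n j * (ip g (\<phi> (Suc j)))\<^sup>2)"
  have le: "(cross_coeff n g j)\<^sup>2 \<le> ?f j" for j
  proof -
    have "(cross_coeff n g j)\<^sup>2 = 4 * b n j * (real n / \<sigma>\<^sup>2 * b n j * (ip g (\<phi> (Suc j)))\<^sup>2)"
      by (simp add: cross_coeff_def power_mult_distrib power_divide power2_eq_square[of "b n j"])
    also have "\<dots> \<le> ?f j"
      using b_nonneg[OF assms(1)] b_mono[OF assms(1), of 0 j] by (intro mult_right_mono) auto
    finally show ?thesis .
  qed
  have s: "summable ?f" by (intro summable_mult[OF summable_shift[OF assms]])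
  show "summable (\<lambda>j. (cross_coeff n g j)\<^sup>2)"
    by (rule summable_comparison_test'[OF s, where N=0]) (use le in simp)
  then have "(\<Sum>j. (cross_coeff n g j)\<^sup>2) \<le> (\<Sum>j. ?f j)" by (intro suminf_le le s)
  also have "\<dots> = 4 * b n 0 * shift n g"
    unfolding shift_def by (rule suminf_mult[OF summable_shift[OF assms]])
  finally show "(\<Sum>j. (cross_coeff n g j)\<^sup>2) \<le> 4 * b n 0 * shift n g" .
qed

text \<open>The dominating series converges on an event that does not depend on g, namely that of
  convergence of the weighted noise squares.\<close>

lemma summable_cross:
  assumes "n \<ge> 1" "g \<in> L2" "summable (\<lambda>j. b n j * (w (\<phi> (Suc j)) \<omega>)\<^sup>2)"
  shows "summable (\<lambda>j. cross_coeff n g j * w (\<phi> (Suc j)) \<omega>)"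
proof (rule summable_comparison_test'[where N=0])
  let ?f = "\<lambda>j. 2 * sqrt (real n) / \<sigma> * (b n j * (ip g (\<phi> (Suc j)))\<^sup>2 + b n j * (w (\<phi> (Suc j)) \<omega>)\<^sup>2)"
  show "summable ?f"
    by (intro summable_mult summable_add summable_b_coeff assms)
  fix j
  have "norm (cross_coeff n g j * w (\<phi> (Suc j)) \<omega>) =
      2 * sqrt (real n) / \<sigma> * (b n j * \<bar>ip g (\<phi> (Suc j)) * w (\<phi> (Suc j)) \<omega>\<bar>)"
    using sigma_pos b_nonneg[OF assms(1)] by (simp add: cross_coeff_def abs_mult)
  also have "\<dots> \<le> 2 * sqrt (real n) / \<sigma> * (b n j * ((ip g (\<phi> (Suc j)))\<^sup>2 + (w (\<phi> (Suc j)) \<omega>)\<^sup>2))"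
    using sigma_pos b_nonneg[OF assms(1)] by (intro mult_left_mono abs_mult_le_sum_squares) auto
  finally show "norm (cross_coeff n g j * w (\<phi> (Suc j)) \<omega>) \<le> ?f j" by (simp only: distrib_left)
qed

lemma AE_summable_b_squares:
  assumes "n \<ge> 1" shows "AE \<omega> in M. summable (\<lambda>j. b n j * (w (\<phi> (Suc j)) \<omega>)\<^sup>2)"
  using assms by (intro AE_summable_weighted_squares b_nonneg summable_b)

lemma prob_cross_ge:
  assumes "n \<ge> 1" "g \<in> L2" "\<epsilon> > 0"
  shows "prob {\<omega> \<in> space M. \<bar>cross n g \<omega>\<bar> \<ge> \<epsilon>} \<le> 4 * b n 0 * shift n g / \<epsilon>\<^sup>2"
proof -
  have "AE \<omega> in M. summable (\<lambda>j. cross_coeff n g j * w (\<phi> (Suc j)) \<omega>)"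
    by (rule AE_mp[OF AE_summable_b_squares[OF assms(1)]]) (intro AE_I2 impI summable_cross assms)
  then have "prob {\<omega> \<in> space M. \<bar>cross n g \<omega>\<bar> \<ge> \<epsilon>} \<le> (\<Sum>j. (cross_coeff n g j)\<^sup>2) / \<epsilon>\<^sup>2"
    unfolding cross_def using assms by (intro prob_series_ge summable_cross_coeff_sq)
  also have "\<dots> \<le> 4 * b n 0 * shift n g / \<epsilon>\<^sup>2"
    by (intro divide_right_mono suminf_cross_coeff_sq_le assms) simp
  finally show ?thesis .
qed

text \<open>The compensator in the statistic centres the noise squares. Where these series diverge,
  \<open>suminf\<close> is a default value and the splitting can fail, so the identity is stated
  almost everywhere.\<close>

lemma AE_test_stat_eq:
  assumes n: "n \<ge> 1" and g: "g \<in> L2"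
  shows "AE \<omega> in M. test_stat \<kappa> \<sigma> \<phi> n (observe w \<sigma> n g \<omega>) = scale n * (S n \<omega> + shift n g + cross n g \<omega>)"
proof (rule AE_mp[OF AE_summable_b_squares[OF n]], intro AE_I2 impI)
  fix \<omega> assume s: "summable (\<lambda>j. b n j * (w (\<phi> (Suc j)) \<omega>)\<^sup>2)"
  let ?X = "\<lambda>j. w (\<phi> (Suc j)) \<omega>" and ?\<theta> = "\<lambda>j. ip g (\<phi> (Suc j))"
  have sS: "summable (\<lambda>j. b n j * ((?X j)\<^sup>2 - 1))"
    using summable_diff[OF s summable_b[OF n]] by (simp add: algebra_simps)
  have kap: "(\<kappa> (Suc j) n)\<^sup>2 = scale n * (real n / \<sigma>\<^sup>2 * b n j)" for j
    using n sigma_pos sd_pos[OF n] by (simp add: scale_def b_def field_simps power_numeral_reduce)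
  have summand: "(\<kappa> (Suc j) n)\<^sup>2 * (?\<theta> j + \<sigma> / sqrt (real n) * ?X j)\<^sup>2 =
     scale n * (b n j * ((?X j)\<^sup>2 - 1) + real n / \<sigma>\<^sup>2 * b n j * (?\<theta> j)\<^sup>2 + cross_coeff n g j * ?X j)
     + \<sigma>\<^sup>2 / real n * (\<kappa> (Suc j) n)\<^sup>2" for j
  proof -
    \<comment> \<open>In terms of the square root of n the identity is rational.\<close>
    define q where "q = sqrt (real n)"
    have q: "q > 0" "real n = q\<^sup>2" using n by (auto simp: q_def)
    show ?thesis unfolding kap cross_coeff_def q_def[symmetric] unfolding q(2)
      using q(1) sigma_pos by (simp add: field_simps power2_eq_square)
  qed
  note sc = summable_cross[OF n g s] and sh = summable_shift[OF n g]
  have "(\<lambda>j. (\<kappa> (Suc j) n)\<^sup>2 * (?\<theta> j + \<sigma> / sqrt (real n) * ?X j)\<^sup>2) sums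
     (scale n * (S n \<omega> + shift n g + cross n g \<omega>) + \<sigma>\<^sup>2 / real n * (\<Sum>j. (\<kappa> (Suc j) n)\<^sup>2))"
    unfolding summand S_def shift_def cross_def
    by (intro sums_add sums_mult summable_sums sS sh sc summable_kappa n)
  then show "test_stat \<kappa> \<sigma> \<phi> n (observe w \<sigma> n g \<omega>) = scale n * (S n \<omega> + shift n g + cross n g \<omega>)"
    unfolding test_stat_def observe_def by (simp add: sums_iff)
qed

section \<open>Error probabilities through the normalised sum\<close>

lemma prob_test_stat_le:
  assumes "n \<ge> 1" "g \<in> L2"
  shows "prob {\<omega> \<in> space M. \<not> test_stat \<kappa> \<sigma> \<phi> n (observe w \<sigma> n g \<omega>) > scale n * z} =
         prob {\<omega> \<in> space M. S n \<omega> + shift n g + cross n g \<omega> \<le> z}"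
proof (rule finite_measure_eq_AE)
  show "AE \<omega> in M. (\<omega> \<in> {\<omega> \<in> space M. \<not> test_stat \<kappa> \<sigma> \<phi> n (observe w \<sigma> n g \<omega>) > scale n * z}) =
      (\<omega> \<in> {\<omega> \<in> space M. S n \<omega> + shift n g + cross n g \<omega> \<le> z})"
    using AE_test_stat_eq[OF assms] scale_pos[OF assms(1)] by (auto simp: not_less)
qed simp_all

lemma type1_error_eq:
  assumes "n \<ge> 1"
  shows "type1_error M w \<sigma> n (\<lambda>Y. test_stat \<kappa> \<sigma> \<phi> n Y > scale n * z) = 1 - prob {\<omega> \<in> space M. S n \<omega> \<le> z}"
proof -
  let ?E = "{\<omega> \<in> space M. \<not> test_stat \<kappa> \<sigma> \<phi> n (observe w \<sigma> n (\<lambda>_. 0) \<omega>) > scale n * z}"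
  have "shift n (\<lambda>_. 0) = 0" "cross n (\<lambda>_. 0) \<omega> = 0" for \<omega>
    by (simp_all add: shift_def cross_def cross_coeff_def ip_zero_left)
  then have "prob ?E = prob {\<omega> \<in> space M. S n \<omega> \<le> z}"
    by (subst prob_test_stat_le[OF assms L2_zero]) simp
  moreover have "space M - ?E = {\<omega> \<in> space M. test_stat \<kappa> \<sigma> \<phi> n (observe w \<sigma> n (\<lambda>_. 0) \<omega>) > scale n * z}"
    by auto
  then have "prob {\<omega> \<in> space M. test_stat \<kappa> \<sigma> \<phi> n (observe w \<sigma> n (\<lambda>_. 0) \<omega>) > scale n * z} = 1 - prob ?E"
    using prob_compl[of ?E] by simp
  ultimately show ?thesis unfolding type1_error_def by simp
qed

text \<open>Acceptance forces S_n below z - h/2 or the linear term beyond h/2 in modulus, where h is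
  the shift. Chebyshev's inequality at the level h/2 gives 16 b_0 / h, which decreases in h; hence
  the bound depends on g only through d.\<close>

lemma type2_error_upper:
  assumes n: "n \<ge> 1" and g: "g \<in> L2" and d: "0 < d" "d \<le> shift n g"
  shows "type2_error M w \<sigma> n (\<lambda>Y. test_stat \<kappa> \<sigma> \<phi> n Y > scale n * z) g
    \<le> prob {\<omega> \<in> space M. S n \<omega> \<le> z - d / 2} + 16 * b n 0 / d"
proof -
  let ?h = "shift n g"
  have "type2_error M w \<sigma> n (\<lambda>Y. test_stat \<kappa> \<sigma> \<phi> n Y > scale n * z) g =
      prob {\<omega> \<in> space M. S n \<omega> + ?h + cross n g \<omega> \<le> z}"
    unfolding type2_error_def by (rule prob_test_stat_le[OF n g])
  also have "\<dots> \<le> prob ({\<omega> \<in> space M. S n \<omega> \<le> z - d / 2} \<union> {\<omega> \<in> space M. \<bar>cross n g \<omega>\<bar> \<ge> ?h / 2})"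
    using d(2) by (intro finite_measure_mono) (auto simp: abs_if field_simps)
  also have "\<dots> \<le> prob {\<omega> \<in> space M. S n \<omega> \<le> z - d / 2} + prob {\<omega> \<in> space M. \<bar>cross n g \<omega>\<bar> \<ge> ?h / 2}"
    by (intro measure_Un_le) auto
  also have "prob {\<omega> \<in> space M. \<bar>cross n g \<omega>\<bar> \<ge> ?h / 2} \<le> 4 * b n 0 * ?h / (?h / 2)\<^sup>2"
    using d by (intro prob_cross_ge n g) auto
  also have "\<dots> = 16 * b n 0 / ?h" using d by (simp add: power2_eq_square)
  also have "\<dots> \<le> 16 * b n 0 / d" using d b_nonneg[OF n, of 0] by (intro divide_left_mono) auto
  finally show ?thesis by simp
qed

text \<open>If S_n is at most z - 2d, one d absorbs the shift and the other the linear term, so the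
  test accepts unless the linear term reaches d in modulus.\<close>

lemma type2_error_lower:
  assumes n: "n \<ge> 1" and g: "g \<in> L2" and d: "0 < d" "shift n g \<le> d"
  shows "type2_error M w \<sigma> n (\<lambda>Y. test_stat \<kappa> \<sigma> \<phi> n Y > scale n * z) g
    \<ge> prob {\<omega> \<in> space M. S n \<omega> \<le> z - 2 * d} - 4 * b n 0 * shift n g / d\<^sup>2"
proof -
  let ?h = "shift n g"
  have "prob {\<omega> \<in> space M. S n \<omega> \<le> z - 2 * d} \<le>
     prob ({\<omega> \<in> space M. S n \<omega> + ?h + cross n g \<omega> \<le> z} \<union> {\<omega> \<in> space M. \<bar>cross n g \<omega>\<bar> \<ge> d})"
    using d(2) by (intro finite_measure_mono) (auto simp: abs_if field_simps)
  also have "\<dots> \<le> prob {\<omega> \<in> space M. S n \<omega> + ?h + cross n g \<omega> \<le> z} + prob {\<omega> \<in> space M. \<bar>cross n g \<omega>\<bar> \<ge> d}"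
    by (intro measure_Un_le) auto
  also have "prob {\<omega> \<in> space M. \<bar>cross n g \<omega>\<bar> \<ge> d} \<le> 4 * b n 0 * ?h / d\<^sup>2"
    by (intro prob_cross_ge n g d)
  also have "prob {\<omega> \<in> space M. S n \<omega> + ?h + cross n g \<omega> \<le> z} =
     type2_error M w \<sigma> n (\<lambda>Y. test_stat \<kappa> \<sigma> \<phi> n Y > scale n * z) g"
    unfolding type2_error_def by (rule prob_test_stat_le[OF n g, symmetric])
  finally show ?thesis by simp
qed

end

subsection \<open>Asymptotics of the weights and of the shift\<close>

lemma real_powr_sequentially_at_top:
  assumes "(a::real) > 0" shows "filterlim (\<lambda>n. real n powr a) at_top sequentially"
proof -
  have "filterlim (\<lambda>n. exp (a * ln (real n))) at_top sequentially"
    using assms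
    by (intro filterlim_compose[OF exp_at_top] filterlim_tendsto_pos_mult_at_top[OF tendsto_const]
          filterlim_compose[OF ln_at_top] filterlim_real_sequentially)
  moreover have "\<forall>\<^sub>F n in sequentially. exp (a * ln (real n)) = real n powr a"
    using eventually_gt_at_top[of 0] by eventually_elim (simp add: powr_def)
  ultimately show ?thesis by (simp add: filterlim_cong cong: filterlim_cong)
qed

context white_noise_detection
begin

section \<open>Growth of k_n and the windows of (A5)\<close>

lemma k_index_lower: "\<exists>c>0. \<forall>n\<ge>1. c * real n powr (2 - 4 * r) \<le> real (k_index \<kappa> n)"
  and k_index_upper: "\<exists>C>0. \<forall>n\<ge>1. real (k_index \<kappa> n) \<le> C * real n powr (2 - 4 * r)"
  using k_bounds by (meson less_le_trans)+

lemma k_index_at_top: "filterlim (\<lambda>n. real (k_index \<kappa> n)) at_top sequentially"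
proof -
  obtain c where c: "c > 0" "\<forall>n\<ge>1. c * real n powr (2 - 4 * r) \<le> real (k_index \<kappa> n)"
    using k_index_lower by blast
  have "filterlim (\<lambda>n. c * real n powr (2 - 4 * r)) at_top sequentially"
    using c(1) r_less
    by (intro filterlim_tendsto_pos_mult_at_top[OF tendsto_const]
          real_powr_sequentially_at_top) auto
  then show ?thesis
    by (rule filterlim_at_top_mono) (use c(2) in \<open>auto simp: eventually_sequentially intro!: exI[of _ 1]\<close>)
qed

lemma eventually_k_index_ge: "\<forall>\<^sub>F n in sequentially. x \<le> real (k_index \<kappa> n)"
  using k_index_at_top by (simp add: filterlim_at_top)

lemma window_subset: assumes "\<delta> > 0" shows "window \<kappa> \<delta> n \<subseteq> {1..nat \<lfloor>real (k_index \<kappa> n) / \<delta>\<rfloor>}"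
proof
  fix j assume j: "j \<in> window \<kappa> \<delta> n"
  then have "0 < real j"
    using assms by (auto simp: window_def simp del: of_nat_0_less_iff intro: le_less_trans[rotated])
  moreover have "real j \<le> real (k_index \<kappa> n) / \<delta>" using j by (simp add: window_def)
  then have "j \<le> nat \<lfloor>real (k_index \<kappa> n) / \<delta>\<rfloor>" by (simp add: le_nat_floor)
  ultimately show "j \<in> {1..nat \<lfloor>real (k_index \<kappa> n) / \<delta>\<rfloor>}" by simp
qed

lemma finite_window: "\<delta> > 0 \<Longrightarrow> finite (window \<kappa> \<delta> n)"
  using window_subset finite_subset by blast

lemma card_window_le: assumes "\<delta> > 0" shows "real (card (window \<kappa> \<delta> n)) \<le> real (k_index \<kappa> n) / \<delta>"
proof -
  have "card (window \<kappa> \<delta> n) \<le> nat \<lfloor>real (k_index \<kappa> n) / \<delta>\<rfloor>"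
    using card_mono[OF _ window_subset[OF assms], of n] by simp
  moreover have "real (k_index \<kappa> n) / \<delta> \<ge> 0" using assms by simp
  ultimately show ?thesis by linarith
qed

text \<open>Usable form of the iterated limit: first \<delta> is fixed so that the inner limit
  exceeds q, then n is taken large.\<close>

lemma window_fourth_powers:
  assumes "q < 1"
  shows "\<exists>\<delta>>0. \<delta> < 1 \<and> (\<forall>\<^sub>F n in sequentially.
    q * (A_seq \<kappa> \<sigma> n * \<sigma> ^ 4 / (real n)\<^sup>2) < (\<Sum>j\<in>window \<kappa> \<delta> n. (\<kappa> j n) ^ 4))"
proof -
  let ?a = "\<lambda>\<delta> n. (real n)\<^sup>2 / \<sigma> ^ 4 * (\<Sum>j\<in>window \<kappa> \<delta> n. (\<kappa> j n) ^ 4) / A_seq \<kappa> \<sigma> n"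
  obtain L where L: "\<forall>\<^sub>F \<delta> in at_right 0. (\<lambda>n. ?a \<delta> n) \<longlonglongrightarrow> L \<delta>" "(L \<longlongrightarrow> 1) (at_right 0)"
    using A5 unfolding assumption_A5_def iterated_limit_def by blast
  have "\<forall>\<^sub>F \<delta> in at_right 0. (\<lambda>n. ?a \<delta> n) \<longlonglongrightarrow> L \<delta> \<and> L \<delta> > q \<and> \<delta> \<in> {0<..<(1::real)}"
    using L(1) order_tendstoD(1)[OF L(2) assms] eventually_at_right_real[of 0 "1::real"]
    by (intro eventually_conj) auto
  then obtain \<delta> where \<delta>: "(\<lambda>n. ?a \<delta> n) \<longlonglongrightarrow> L \<delta>" "L \<delta> > q" "0 < \<delta>" "\<delta> < 1"
    using eventually_happens'[OF trivial_limit_at_right_real] by (metis (no_types, lifting) greaterThanLessThan_iff)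
  have "\<forall>\<^sub>F n in sequentially. q * (A_seq \<kappa> \<sigma> n * \<sigma> ^ 4 / (real n)\<^sup>2) < (\<Sum>j\<in>window \<kappa> \<delta> n. (\<kappa> j n) ^ 4)"
    using order_tendstoD(1)[OF \<delta>(1,2)] eventually_ge_at_top[of 1]
  proof eventually_elim
    case (elim n)
    then show ?case using A_seq_pos[of n] sigma_pos by (simp add: field_simps)
  qed
  then show ?thesis using \<delta> by blast
qed

text \<open>The first coefficient lies below every window, so (A5) makes it asymptotically negligible.\<close>

lemma b_0_tendsto_0: "(\<lambda>n. b n 0) \<longlonglongrightarrow> 0"
proof -
  have "\<forall>\<^sub>F n in sequentially. (b n 0)\<^sup>2 < \<eta>" if \<eta>: "\<eta> > 0" for \<eta>
  proof -
    from window_fourth_powers[of "1 - \<eta>"] \<eta> obtain \<delta> where \<delta>: "0 < \<delta>" "\<delta> < 1"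
      "\<forall>\<^sub>F n in sequentially. (1 - \<eta>) * (A_seq \<kappa> \<sigma> n * \<sigma> ^ 4 / (real n)\<^sup>2) < (\<Sum>j\<in>window \<kappa> \<delta> n. (\<kappa> j n) ^ 4)"
      by auto
    \<comment> \<open>Once k_n is at least 1/\<delta>, the window starts above 1. Its fourth powers
      exceed the share 1 - \<eta> of the total, so the first one is less than the share
      \<eta>.\<close>
    show ?thesis using \<delta>(3) eventually_ge_at_top[of 1] eventually_k_index_ge[of "1/\<delta>"]
    proof eventually_elim
      case (elim n)
      then have n: "n \<ge> 1" by simp
      let ?A = "A_seq \<kappa> \<sigma> n * \<sigma> ^ 4 / (real n)\<^sup>2"
      have sub: "window \<kappa> \<delta> n \<subseteq> {2..nat \<lfloor>real (k_index \<kappa> n) / \<delta>\<rfloor>}"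
      proof
        fix j assume j: "j \<in> window \<kappa> \<delta> n"
        have "1 \<le> \<delta> * real (k_index \<kappa> n)" using elim(3) \<delta>(1) by (simp add: field_simps)
        then have "1 < real j" using j by (simp add: window_def)
        then show "j \<in> {2..nat \<lfloor>real (k_index \<kappa> n) / \<delta>\<rfloor>}" using window_subset[OF \<delta>(1), of n] j by auto
      qed
      define N where "N = nat \<lfloor>real (k_index \<kappa> n) / \<delta>\<rfloor>"
      have "(\<kappa> 1 n) ^ 4 + (\<Sum>j\<in>window \<kappa> \<delta> n. (\<kappa> j n) ^ 4) = (\<Sum>j\<in>insert 1 (window \<kappa> \<delta> n). (\<kappa> j n) ^ 4)"
        using finite_window[OF \<delta>(1)] sub by (subst sum.insert) auto
      also have "\<dots> \<le> (\<Sum>j\<in>{1..Suc N}. (\<kappa> j n) ^ 4)"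
        using sub unfolding N_def by (intro sum_mono2) auto
      also have "\<dots> = (\<Sum>j<Suc N. (\<kappa> (Suc j) n) ^ 4)" by (simp only: One_nat_def sum.atLeast1_atMost_eq)
      also have "\<dots> \<le> (\<Sum>j. (\<kappa> (Suc j) n) ^ 4)"
        by (intro sum_le_suminf summable_kappa4 n) auto
      also have "\<dots> = ?A" by (rule sum_kappa4_eq[OF n])
      finally have "(\<kappa> 1 n) ^ 4 < \<eta> * ?A" using elim(1)
        unfolding left_diff_distrib mult_1_left by linarith
      then have "(b n 0)\<^sup>2 < (real n)\<^sup>2 / (\<sigma> ^ 4 * (2 * A_seq \<kappa> \<sigma> n)) * (\<eta> * ?A)"
        unfolding b_sq[OF n] using n sigma_pos A_seq_pos[OF n] by (intro mult_strict_left_mono) auto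
      also have "\<dots> = \<eta> / 2" using n sigma_pos A_seq_pos[OF n] by (simp add: field_simps)
      finally show ?case using \<eta> by simp
    qed
  qed
  then have "(\<lambda>n. (b n 0)\<^sup>2) \<longlonglongrightarrow> 0"
    by (intro order_tendstoI) (auto intro!: always_eventually intro: less_le_trans[OF _ zero_le_power2])
  from tendsto_real_sqrt[OF this] show ?thesis by (simp add: tendsto_rabs_zero_iff)
qed

text \<open>Stated along an arbitrary sequence p because the negative part observes only at the
  noise levels \<open>m n\<close>. The requirement that p be positive keeps the normalisation of the
  weights valid at every term.\<close>

lemma S_clt:
  assumes "\<And>n. p n \<ge> 1" "filterlim p at_top sequentially"
  shows "(\<lambda>n. prob {\<omega> \<in> space M. S (p n) \<omega> \<le> z}) \<longlonglongrightarrow> cdf std_normal_distribution z"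
  unfolding S_def
proof (rule weighted_chi_square_clt[where \<epsilon> = "\<lambda>n. b (p n) 0"])
  show "(\<lambda>n. b (p n) 0) \<longlonglongrightarrow> 0" by (rule filterlim_compose[OF b_0_tendsto_0 assms(2)])
qed (auto intro!: b_nonneg summable_b b_sq_sums b_mono assms(1))

text \<open>A window carries at least half of the fourth powers, has at most k_n / \<delta> members,
  and each of its coefficients is bounded by the one at index \<delta> k_n; so the weight there is
  at least of order k_n^(-1/2). Condition (A4) carries the bound from \<delta> k_n to D k_n.\<close>

lemma b_floor_lower:
  assumes "D > 1"
  shows "\<exists>c>0. \<forall>\<^sub>F n in sequentially. nat \<lfloor>D * real (k_index \<kappa> n)\<rfloor> \<ge> 1 \<and>
     c / sqrt (real (k_index \<kappa> n)) \<le> b n (nat \<lfloor>D * real (k_index \<kappa> n)\<rfloor> - 1)"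
proof -
  let ?k = "\<lambda>n. real (k_index \<kappa> n)"
  obtain \<delta> where \<delta>: "0 < \<delta>" "\<delta> < 1"
     "\<forall>\<^sub>F n in sequentially. (1/2) * (A_seq \<kappa> \<sigma> n * \<sigma> ^ 4 / (real n)\<^sup>2) < (\<Sum>j\<in>window \<kappa> \<delta> n. (\<kappa> j n) ^ 4)"
    using window_fourth_powers[of "1/2"] by auto
  let ?u = "\<lambda>n. nat \<lfloor>D * ?k n\<rfloor>" and ?l = "\<lambda>n. nat \<lfloor>\<delta> * ?k n\<rfloor>"
  obtain C where C: "C > 0" "\<forall>\<^sub>F n in sequentially. C < (\<kappa> (?u n) n)\<^sup>2 / (\<kappa> (?l n) n)\<^sup>2"
  proof -
    have "\<exists>C1>0. \<exists>C2<1. \<forall>\<^sub>F n in sequentially.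
           (let q = (\<kappa> (nat \<lfloor>(1 + (D - 1)) * ?k n\<rfloor>) n)\<^sup>2 / (\<kappa> (nat \<lfloor>(1 - (1 - \<delta>)) * ?k n\<rfloor>) n)\<^sup>2
            in C1 < q \<and> q < C2)"
      \<comment> \<open>The parameters D - 1 and 1 - \<delta> turn the two indices of (A4) into D
        k_n and \<delta> k_n.\<close>
      using A4[unfolded assumption_A4_def, rule_format, of "D - 1" "1 - \<delta>"] assms \<delta> by simp
    then obtain C1 C2 where "C1 > 0" "\<forall>\<^sub>F n in sequentially.
           (let q = (\<kappa> (?u n) n)\<^sup>2 / (\<kappa> (?l n) n)\<^sup>2 in C1 < q \<and> q < C2)" by auto
    then show ?thesis by (intro that[of C1]) (auto simp: Let_def elim: eventually_mono)
  qed
  have "\<forall>\<^sub>F n in sequentially. ?u n \<ge> 1 \<and> C * sqrt \<delta> / 2 / sqrt (?k n) \<le> b n (?u n - 1)"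
    using \<delta>(3) C(2) eventually_ge_at_top[of 1] eventually_k_index_ge[of "1/\<delta>"]
  proof eventually_elim
    case (elim n)
    then have n: "n \<ge> 1" by simp
    have dk: "1 \<le> \<delta> * ?k n" using elim(4) \<delta>(1) by (simp add: field_simps)
    then have kpos: "?k n > 0" using \<delta>(1) zero_less_mult_pos[of \<delta> "?k n"] by linarith
    have l: "?l n \<ge> 1" using dk by linarith
    have "\<delta> * ?k n \<le> D * ?k n" using \<delta>(2) assms kpos by (intro mult_right_mono) auto
    then have u: "?u n \<ge> 1" using dk by linarith
    let ?x = "(\<kappa> (?l n) n)\<^sup>2"
    have "(\<Sum>j\<in>window \<kappa> \<delta> n. (\<kappa> j n) ^ 4) \<le> (\<Sum>j\<in>window \<kappa> \<delta> n. ?x\<^sup>2)"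
    proof (intro sum_mono)
      fix j assume "j \<in> window \<kappa> \<delta> n"
      then have "\<delta> * ?k n < real j" by (simp add: window_def)
      then have "?l n \<le> j" by linarith
      then have "((\<kappa> j n)\<^sup>2)\<^sup>2 \<le> ?x\<^sup>2" using l by (intro power_mono kappa_mono n) auto
      then show "(\<kappa> j n) ^ 4 \<le> ?x\<^sup>2" by (simp flip: power_mult)
    qed
    also have "\<dots> = real (card (window \<kappa> \<delta> n)) * ?x\<^sup>2" by simp
    also have "\<dots> \<le> ?k n / \<delta> * ?x\<^sup>2" by (intro mult_right_mono card_window_le \<delta>) auto
    finally have "(1/2) * (A_seq \<kappa> \<sigma> n * \<sigma> ^ 4 / (real n)\<^sup>2) \<le> ?k n / \<delta> * ?x\<^sup>2" using elim(1) by linarith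
    moreover have "y * \<delta> / (2 * ?k n) \<le> x" if "(1/2) * y \<le> ?k n / \<delta> * x" for x y :: real
      using that kpos \<delta>(1) by (simp add: field_simps)
    ultimately have x2: "A_seq \<kappa> \<sigma> n * \<sigma> ^ 4 / (real n)\<^sup>2 * \<delta> / (2 * ?k n) \<le> ?x\<^sup>2"
      by blast
    have x0: "?x > 0"
    proof -
      have "A_seq \<kappa> \<sigma> n * \<sigma> ^ 4 / (real n)\<^sup>2 * \<delta> / (2 * ?k n) > 0"
        using kpos \<delta>(1) n sigma_pos A_seq_pos[OF n] by simp
      then have "?x\<^sup>2 > 0" using x2 by linarith
      then show ?thesis by (simp add: zero_less_power2)
    qed
    have su: "Suc (?u n - 1) = ?u n" "Suc (?l n - 1) = ?l n" using u l by linarith+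
    have "C * ?x \<le> (\<kappa> (?u n) n)\<^sup>2" using elim(2) x0 by (simp add: field_simps less_imp_le)
    then have "real n * (C * ?x) / (\<sigma>\<^sup>2 * sd n) \<le> b n (?u n - 1)"
      unfolding b_def su using sd_pos[OF n] by (intro divide_right_mono mult_left_mono) auto
    then have "C * b n (?l n - 1) \<le> b n (?u n - 1)"
      unfolding b_def su by (simp add: mult.left_commute)
    moreover have "sqrt \<delta> / 2 / sqrt (?k n) \<le> b n (?l n - 1)"
    proof -
      have "(real n)\<^sup>2 / (\<sigma> ^ 4 * (2 * A_seq \<kappa> \<sigma> n)) * (A_seq \<kappa> \<sigma> n * \<sigma> ^ 4 / (real n)\<^sup>2 * \<delta> / (2 * ?k n)) \<le>
         (real n)\<^sup>2 / (\<sigma> ^ 4 * (2 * A_seq \<kappa> \<sigma> n)) * ?x\<^sup>2"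
        using x2 A_seq_pos[OF n] by (intro mult_left_mono) auto
      also have "\<dots> = (b n (?l n - 1))\<^sup>2" unfolding b_sq[OF n] su by (simp flip: power_mult)
      also have "(real n)\<^sup>2 / (\<sigma> ^ 4 * (2 * A_seq \<kappa> \<sigma> n)) * (A_seq \<kappa> \<sigma> n * \<sigma> ^ 4 / (real n)\<^sup>2 * \<delta> / (2 * ?k n)) = \<delta> / (4 * ?k n)"
        using n sigma_pos A_seq_pos[OF n] by (simp add: field_simps)
      also have "\<delta> / (4 * ?k n) = (sqrt \<delta> / 2 / sqrt (?k n))\<^sup>2"
        using \<delta>(1) kpos by (simp add: power_divide)
      finally show ?thesis by (rule power2_le_imp_le) (rule b_nonneg[OF n])
    qed
    then have "C * (sqrt \<delta> / 2 / sqrt (?k n)) \<le> C * b n (?l n - 1)" using C(1) by (intro mult_left_mono) auto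
    ultimately show ?case using u by simp
  qed
  then show ?thesis using C(1) \<delta>(1) by (intro exI[of _ "C * sqrt \<delta> / 2"]) auto
qed

lemma shift_lower:
  assumes P: "P > 0" and c: "c > 0"
  shows "\<exists>d>0. \<forall>\<^sub>F n in sequentially. \<forall>g\<in>besov_ball \<phi> s P. l2norm g \<ge> c * real n powr (- r) \<longrightarrow> d \<le> shift n g"
proof -
  let ?k = "\<lambda>n. real (k_index \<kappa> n)"
  obtain c0 where c0: "c0 > 0" "\<forall>n\<ge>1. c0 * real n powr (2 - 4 * r) \<le> ?k n" using k_index_lower by blast
  obtain C0 where C0: "C0 > 0" "\<forall>n\<ge>1. ?k n \<le> C0 * real n powr (2 - 4 * r)" using k_index_upper by blast
  \<comment> \<open>Makes the part of g beyond index D k_n at most half of the squared norm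
    guaranteed by the alternative.\<close>
  obtain D where D: "D > 1" "P * (D * c0) powr (- (2 * s)) \<le> c\<^sup>2 / 2"
  proof -
    have "filterlim (\<lambda>D. D * c0) at_top at_top"
      using c0(1) by (intro filterlim_at_top_mult_tendsto_pos[OF tendsto_const] filterlim_ident)
    then have "((\<lambda>D. P * (D * c0) powr (- (2 * s))) \<longlongrightarrow> P * 0) at_top"
      using s_pos by (intro tendsto_mult_left tendsto_neg_powr) auto
    then have "\<forall>\<^sub>F D in at_top. P * (D * c0) powr (- (2 * s)) < c\<^sup>2 / 2"
      using c by (intro order_tendstoD) auto
    then have "\<forall>\<^sub>F D in at_top. P * (D * c0) powr (- (2 * s)) < c\<^sup>2 / 2 \<and> D > 1"
      using eventually_gt_at_top[of "1::real"] by eventually_elim auto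
    then show ?thesis using that by (auto simp: eventually_at_top_linorder)
  qed
  obtain c1 where c1: "c1 > 0" "\<forall>\<^sub>F n in sequentially. nat \<lfloor>D * ?k n\<rfloor> \<ge> 1 \<and>
     c1 / sqrt (?k n) \<le> b n (nat \<lfloor>D * ?k n\<rfloor> - 1)" using b_floor_lower[OF D(1)] by blast
  \<comment> \<open>Weight c1 k_n^(-1/2) times n / \<sigma>^2 times the remaining half c^2 n^(-2r) /
    2; after k_n is bounded by C0 n^(2-4r), all powers of n cancel.\<close>
  define d where "d = c1 * c\<^sup>2 / (2 * \<sigma>\<^sup>2 * sqrt C0)"
  have d: "d > 0" using c1 c C0 sigma_pos by (simp add: d_def)
  \<comment> \<open>The calibration of s: it converts the decay of the ball at index n^(2-4r) into
    n^(-2r).\<close>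
  have rs: "(2 - 4 * r) * (2 * s) = 2 * r" using r_less by (simp add: s_eq)
  have "\<forall>\<^sub>F n in sequentially. \<forall>g\<in>besov_ball \<phi> s P. l2norm g \<ge> c * real n powr (- r) \<longrightarrow> d \<le> shift n g"
    using c1(2) eventually_ge_at_top[of 1]
  proof eventually_elim
    case (elim n)
    then have n: "n \<ge> 1" by simp
    define N where "N = nat \<lfloor>D * ?k n\<rfloor>"
    have N: "N \<ge> 1" "c1 / sqrt (?k n) \<le> b n (N - 1)" using elim by (auto simp: N_def)
    have np: "real n powr (2 - 4 * r) > 0" using n by simp
    have kpos: "?k n > 0" using c0 n np by (meson less_le_trans mult_pos_pos)
    show ?case
    proof (intro ballI impI)
      fix g assume g: "g \<in> besov_ball \<phi> s P" and gn: "c * real n powr (- r) \<le> l2norm g"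
      have gL: "g \<in> L2" using g by (simp add: besov_ball_def)
      have t1: "real (Suc N) powr (2 * s) * tail g N \<le> P"
        using g besov_ball_iff_tail[OF s_pos] by blast
      have tl: "tail g N \<le> c\<^sup>2 / 2 * real n powr (- (2 * r))"
      proof -
        have "tail g N \<le> P * real (Suc N) powr (- (2 * s))"
          using t1 by (simp add: powr_minus field_simps)
        also have "\<dots> \<le> P * (D * c0 * real n powr (2 - 4 * r)) powr (- (2 * s))"
        proof (intro mult_left_mono powr_mono2')
          have "D * (c0 * real n powr (2 - 4 * r)) \<le> D * ?k n"
            using c0(2) n D(1) by (intro mult_left_mono) auto
          also have "\<dots> \<le> real (Suc N)" unfolding N_def by linarith
          finally show "D * c0 * real n powr (2 - 4 * r) \<le> real (Suc N)" by (simp add: mult.assoc)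
        qed (use P D(1) c0(1) np s_pos in auto)
        also have "\<dots> = P * (D * c0) powr (- (2 * s)) * real n powr (- (2 * r))"
          using D(1) c0(1) by (simp only: powr_mult powr_powr mult_minus_right rs mult.assoc)
        also have "\<dots> \<le> c\<^sup>2 / 2 * real n powr (- (2 * r))" by (intro mult_right_mono D) auto
        finally show ?thesis .
      qed
      have "c\<^sup>2 * real n powr (- (2 * r)) = (c * real n powr (- r))\<^sup>2"
        by (simp add: power_mult_distrib power2_eq_square[of "_ powr _"] flip: powr_add)
      also have "\<dots> \<le> (l2norm g)\<^sup>2" using gn c by (intro power_mono) auto
      finally have head: "c\<^sup>2 / 2 * real n powr (- (2 * r)) \<le> (\<Sum>j<N. (ip g (\<phi> (Suc j)))\<^sup>2)"
        using tl by (simp add: l2norm_sq tail_def sum.atLeast1_atMost_eq)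
      have "d \<le> real n / \<sigma>\<^sup>2 * (c1 / sqrt (?k n)) * (c\<^sup>2 / 2 * real n powr (- (2 * r)))"
      proof -
        have "sqrt (?k n) \<le> sqrt (C0 * real n powr (2 - 4 * r))" using C0(2) n by simp
        also have "\<dots> = sqrt C0 * real n powr (1 - 2 * r)"
          by (simp add: real_sqrt_mult powr_half_sqrt[symmetric] powr_powr diff_divide_distrib)
        finally have "1 / (sqrt C0 * real n powr (1 - 2 * r)) \<le> 1 / sqrt (?k n)"
          using kpos by (intro divide_left_mono) (use n C0(1) in auto)
        then have "real n * real n powr (- (2 * r)) * (1 / (sqrt C0 * real n powr (1 - 2 * r))) \<le>
            real n * real n powr (- (2 * r)) * (1 / sqrt (?k n))" by (intro mult_left_mono) auto
        moreover have "real n * real n powr (- (2 * r)) = real n powr (1 - 2 * r)"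
          using n by (simp add: powr_diff powr_minus field_simps)
        ultimately have "1 / sqrt C0 \<le> real n * real n powr (- (2 * r)) * (1 / sqrt (?k n))"
          using n by simp
        then have "c1 * c\<^sup>2 / (2 * \<sigma>\<^sup>2) * (1 / sqrt C0) \<le>
           c1 * c\<^sup>2 / (2 * \<sigma>\<^sup>2) * (real n * real n powr (- (2 * r)) * (1 / sqrt (?k n)))"
          using c1 by (intro mult_left_mono) auto
        then show ?thesis by (simp add: d_def mult_ac)
      qed
      also have "\<dots> \<le> real n / \<sigma>\<^sup>2 * b n (N - 1) * (\<Sum>j<N. (ip g (\<phi> (Suc j)))\<^sup>2)"
        using N(2) head b_nonneg[OF n] c1(1) by (intro mult_mono) auto
      also have "\<dots> = (\<Sum>j<N. real n / \<sigma>\<^sup>2 * b n (N - 1) * (ip g (\<phi> (Suc j)))\<^sup>2)"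
        by (rule sum_distrib_left)
      also have "\<dots> \<le> (\<Sum>j<N. real n / \<sigma>\<^sup>2 * b n j * (ip g (\<phi> (Suc j)))\<^sup>2)"
        by (intro sum_mono mult_right_mono mult_left_mono b_mono n) auto
      also have "\<dots> \<le> shift n g"
        unfolding shift_def using b_nonneg[OF n] by (intro sum_le_suminf summable_shift n gL) auto
      finally show "d \<le> shift n g" .
    qed
  qed
  then show ?thesis using d by blast
qed

text \<open>Only indices above i contribute, and there the weights are at most i^(-1/2); what is
  left is the full squared norm by Parseval's identity.\<close>

lemma shift_upper:
  assumes n: "n \<ge> 1" and g: "g \<in> L2" and i: "i \<ge> 1"
    and z: "\<And>j. 1 \<le> j \<Longrightarrow> j \<le> i \<Longrightarrow> ip g (\<phi> j) = 0"
  shows "shift n g \<le> real n * ip g g / (\<sigma>\<^sup>2 * sqrt (real i))"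
proof -
  have "shift n g \<le> (\<Sum>j. real n / \<sigma>\<^sup>2 * (1 / sqrt (real i)) * (ip g (\<phi> (Suc j)))\<^sup>2)"
    unfolding shift_def
  proof (intro suminf_le summable_shift summable_mult summable_coeff n g)
    fix j
    show "real n / \<sigma>\<^sup>2 * b n j * (ip g (\<phi> (Suc j)))\<^sup>2 \<le> real n / \<sigma>\<^sup>2 * (1 / sqrt (real i)) * (ip g (\<phi> (Suc j)))\<^sup>2"
    proof (cases "j < i")
      case False
      have "b n j \<le> 1 / sqrt (2 * real (Suc j))" by (rule b_le_inverse_sqrt[OF n])
      also have "\<dots> \<le> 1 / sqrt (real i)" using False i by (intro divide_left_mono) auto
      finally show ?thesis by (intro mult_right_mono mult_left_mono) auto
    qed (simp add: z)
  qed
  also have "\<dots> = real n / \<sigma>\<^sup>2 * (1 / sqrt (real i)) * ip g g"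
    by (subst suminf_mult[OF summable_coeff[OF g]]) (simp add: sums_unique[OF parseval[OF g], symmetric])
  finally show ?thesis by simp
qed

end

subsection \<open>Detection and failure of detection\<close>

context white_noise_detection
begin

text \<open>Needed because the supremum of type II errors over an empty set is a junk value.\<close>

lemma eventually_detectable_nonempty:
  assumes P: "P > 0" and c: "c > 0"
  shows "\<forall>\<^sub>F n in sequentially. {g \<in> besov_ball \<phi> s P. l2norm g \<ge> c * real n powr (- r)} \<noteq> {}"
proof -
  let ?g = "\<lambda>t. sqrt P * real 1 powr (- s) * \<phi> 1 t"
  have g: "?g \<in> besov_ball \<phi> s P"
    using greedy_sequence_phi[OF s_pos P] unfolding greedy_sequence_def by blast
  have "ip ?g ?g = P"
    using tail_scaled_phi[of 1 "sqrt P * real 1 powr (- s)" 0] P by (simp add: tail_def)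
  then have ng: "l2norm ?g = sqrt P" by (simp add: l2norm_def)
  have "(\<lambda>n. c * real n powr (- r)) \<longlonglongrightarrow> c * 0"
    using r_pos by (intro tendsto_mult_left tendsto_neg_powr filterlim_real_sequentially) auto
  then have "\<forall>\<^sub>F n in sequentially. c * real n powr (- r) < sqrt P"
    using P by (intro order_tendstoD) auto
  then show ?thesis
  proof eventually_elim
    case (elim n)
    then have "?g \<in> {g \<in> besov_ball \<phi> s P. l2norm g \<ge> c * real n powr (- r)}" using g ng by simp
    then show ?case by blast
  qed
qed

text \<open>The threshold is the normal quantile times \<open>scale n\<close>. With d a lower bound
  for the shift on the alternatives, the type II errors are at most \<Phi>(z - d/2) + o(1),
  uniformly, and this stays strictly below \<Phi>(z) = 1 - \<alpha>.\<close>

lemma consistent_tests: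
  assumes P: "P > 0" and c: "c > 0" and \<alpha>: "0 < \<alpha>" "\<alpha> < 1"
  shows "\<exists>K. (\<forall>n\<ge>1. generated_by (test_stat \<kappa> \<sigma> \<phi> n) (K n)) \<and>
           (\<lambda>n. type1_error M w \<sigma> n (K n)) \<longlonglongrightarrow> \<alpha> \<and>
           limsup (\<lambda>n. ereal (type1_error M w \<sigma> n (K n) +
             type2_error_sup M w \<sigma> n (K n)
               {g \<in> besov_ball \<phi> s P. l2norm g \<ge> c * real n powr (- r)})) < 1"
proof -
  obtain z where z: "cdf std_normal_distribution z = 1 - \<alpha>" using std_normal_quantile[of "1 - \<alpha>"] \<alpha> by auto
  let ?F = "\<lambda>n x. prob {\<omega> \<in> space M. S n \<omega> \<le> x}"
  let ?\<Phi> = "cdf std_normal_distribution"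
  let ?V = "\<lambda>n. {g \<in> besov_ball \<phi> s P. l2norm g \<ge> c * real n powr (- r)}"
  define K where "K n Y \<longleftrightarrow> test_stat \<kappa> \<sigma> \<phi> n Y > scale n * z" for n Y
  have K: "K n = (\<lambda>Y. test_stat \<kappa> \<sigma> \<phi> n Y > scale n * z)" for n by (simp add: K_def fun_eq_iff)
  \<comment> \<open>Nothing is assumed at n = 0, so the limit theorem is applied to the sequence
    \<open>Suc n\<close>.\<close>
  have F: "(\<lambda>n. ?F n x) \<longlonglongrightarrow> ?\<Phi> x" for x
    by (rule LIMSEQ_imp_Suc, rule S_clt) (simp_all add: filterlim_Suc)
  have t1: "\<forall>\<^sub>F n in sequentially. type1_error M w \<sigma> n (K n) = 1 - ?F n z"
    using eventually_ge_at_top[of 1] unfolding K by eventually_elim (rule type1_error_eq)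
  have "(\<lambda>n. 1 - ?F n z) \<longlonglongrightarrow> 1 - ?\<Phi> z" by (intro tendsto_intros F)
  then have T1: "(\<lambda>n. type1_error M w \<sigma> n (K n)) \<longlonglongrightarrow> \<alpha>"
    using t1 by (simp add: z tendsto_cong)
  obtain d where d: "d > 0" "\<forall>\<^sub>F n in sequentially. \<forall>g\<in>besov_ball \<phi> s P. l2norm g \<ge> c * real n powr (- r) \<longrightarrow> d \<le> shift n g"
    using shift_lower[OF P c] by blast
  have t2: "\<forall>\<^sub>F n in sequentially. type2_error_sup M w \<sigma> n (K n) (?V n) \<le> ?F n (z - d / 2) + 16 * b n 0 / d"
    using d(2) eventually_ge_at_top[of 1] eventually_detectable_nonempty[OF P c]
  proof eventually_elim
    case (elim n)
    show ?case unfolding type2_error_sup_def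
    proof (rule cSUP_least)
      fix g assume "g \<in> ?V n"
      then show "type2_error M w \<sigma> n (K n) g \<le> ?F n (z - d / 2) + 16 * b n 0 / d"
        unfolding K using elim(1,2) d(1) by (intro type2_error_upper) (auto simp: besov_ball_def)
    qed (rule elim(3))
  qed
  \<comment> \<open>The midpoint between the limiting bound and 1: a fixed number below 1 that
    eventually dominates the sum of the errors.\<close>
  define q where "q = (\<alpha> + ?\<Phi> (z - d / 2) + 1) / 2"
  have "?\<Phi> (z - d / 2) < 1 - \<alpha>" using std_normal_cdf_strict_mono[of "z - d / 2" z] d(1) z by simp
  then have q: "\<alpha> + ?\<Phi> (z - d / 2) + 16 * 0 / d < q" "q < 1" by (auto simp: q_def)
  have "(\<lambda>n. type1_error M w \<sigma> n (K n) + ?F n (z - d / 2) + 16 * b n 0 / d)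
      \<longlonglongrightarrow> \<alpha> + ?\<Phi> (z - d / 2) + 16 * 0 / d"
    using d(1) by (intro tendsto_intros T1 F b_0_tendsto_0) auto
  from order_tendstoD(2)[OF this q(1)] t2
  have "\<forall>\<^sub>F n in sequentially. ereal (type1_error M w \<sigma> n (K n) +
             type2_error_sup M w \<sigma> n (K n) (?V n)) \<le> ereal q"
    by eventually_elim simp
  then have "limsup (\<lambda>n. ereal (type1_error M w \<sigma> n (K n) +
             type2_error_sup M w \<sigma> n (K n) (?V n))) \<le> ereal q" by (rule Limsup_bounded)
  also have "\<dots> < 1" using q(2) by (simp flip: one_ereal_def)
  finally show ?thesis using T1
    by (intro exI[of _ K]) (auto simp: generated_by_def K_def)
qed

text \<open>Since f lies in no ball, the scaled tails are unbounded. Finitely many indices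
  contribute a bounded amount, so arbitrarily large values occur at arbitrarily large indices, where
  the tail is also at most 1.\<close>

lemma slow_tail_subsequence:
  assumes f: "f \<in> L2" "f \<notin> besov_space \<phi> s"
  shows "\<exists>i::nat \<Rightarrow> nat. \<forall>n. n < i n \<and> tail f (i n) \<le> 1 \<and> real n < real (i n) powr (2 * s) * tail f (i n)"
proof (rule choice, rule allI)
  fix n :: nat
  have "\<forall>\<^sub>F N in sequentially. tail f N < 1" using order_tendstoD(2)[OF tail_tendsto[OF f(1)]] by simp
  then obtain N0 where N0: "\<And>N. N \<ge> N0 \<Longrightarrow> tail f N < 1" by (auto simp: eventually_sequentially)
  define N where "N = max N0 n"
  \<comment> \<open>The first entry exceeds everything reached at indices up to N and forces i > N;
    the factor 2^(2s) in the second pays for replacing i + 1 by i.\<close>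
  define P where "P = max (real (Suc N) powr (2 * s) * tail f 0) (real (Suc n) * 2 powr (2 * s))"
  have "P > 0" by (simp add: P_def less_max_iff_disj)
  then have "f \<notin> besov_ball \<phi> s P" using f(2) by (auto simp: besov_space_def)
  then obtain i where i: "real (Suc i) powr (2 * s) * tail f i > P"
    using f(1) besov_ball_iff_tail[OF s_pos] by (auto simp: not_le)
  have iN: "i > N"
  proof (rule ccontr)
    assume "\<not> i > N"
    then have "real (Suc i) powr (2 * s) * tail f i \<le> real (Suc N) powr (2 * s) * tail f 0"
      using s_pos f(1) by (intro mult_mono powr_mono2 tail_mono tail_nonneg) auto
    then show False using i by (simp add: P_def)
  qed
  have "real (Suc n) * 2 powr (2 * s) < real (Suc i) powr (2 * s) * tail f i" using i by (simp add: P_def)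
  also have "\<dots> \<le> (2 * real i) powr (2 * s) * tail f i"
    using iN s_pos f(1) by (intro mult_right_mono powr_mono2 tail_nonneg) auto
  also have "\<dots> = (real i powr (2 * s) * tail f i) * 2 powr (2 * s)" by (simp add: powr_mult)
  finally have "real (Suc n) < real i powr (2 * s) * tail f i" by simp
  then show "\<exists>i. n < i \<and> tail f i \<le> 1 \<and> real n < real i powr (2 * s) * tail f i"
    using iN N0[of i] by (intro exI[of _ i]) (auto simp: N_def intro: less_imp_le)
qed

text \<open>The sequences \<open>i\<close> and \<open>m\<close> depend on f alone: the noise level
  is matched to the norm of the tail, and the resulting shift tends to 0. They are fixed before
  \<alpha> and the tests, so they defeat every choice of these.\<close>

lemma undetectable_tails:
  assumes f: "f \<in> L2" "f \<notin> besov_space \<phi> s" and a: "\<And>i. i \<ge> 1 \<Longrightarrow> a i \<noteq> 0"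
  defines "e \<equiv> \<lambda>i t. a i * \<phi> i t"
  shows "\<exists>(i :: nat \<Rightarrow> nat) (m :: nat \<Rightarrow> nat) c1 C1.
         (\<forall>n. i n \<ge> 1 \<and> m n \<ge> 1) \<and> filterlim i at_top sequentially \<and> 0 < c1 \<and> c1 < C1 \<and>
         (\<forall>n. c1 * real (m n) powr (- r) < l2norm (f_tilde e f (i n)) \<and>
              l2norm (f_tilde e f (i n)) < C1 * real (m n) powr (- r)) \<and>
         (\<forall>\<alpha> K. 0 < \<alpha> \<and> \<alpha> < 1 \<and>
              (\<forall>n. generated_by (test_stat \<kappa> \<sigma> \<phi> (m n)) (K n)) \<and>
              (\<lambda>n. type1_error M w \<sigma> (m n) (K n)) \<longlonglongrightarrow> \<alpha> \<longrightarrow>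
            liminf (\<lambda>n. ereal (type1_error M w \<sigma> (m n) (K n) +
              type2_error M w \<sigma> (m n) (K n) (f_tilde e f (i n)))) \<ge> 1)"
proof -
  obtain i :: "nat \<Rightarrow> nat" where i: "\<And>n. n < i n" "\<And>n. tail f (i n) \<le> 1"
      "\<And>n. real n < real (i n) powr (2 * s) * tail f (i n)"
    using slow_tail_subsequence[OF f] by blast
  define \<tau> where "\<tau> n = tail f (i n)" for n
  \<comment> \<open>The real solution of x^(-r) = norm of the tail. As the tail is at most 1, x is
    at least 1, so rounding up at most doubles it and the norm stays of order m^(-r).\<close>
  define x where "x n = \<tau> n powr (- 1 / (2 * r))" for n
  define m where "m n = nat \<lceil>x n\<rceil>" for n
  define g where "g n = f_tilde e f (i n)" for n
  have i1: "i n \<ge> 1" for n using i(1)[of n] by linarith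
  have itop: "filterlim i at_top sequentially"
    by (rule filterlim_at_top_mono[OF filterlim_ident]) (use i(1) in \<open>auto intro!: always_eventually less_imp_le\<close>)
  have \<tau>0: "\<tau> n > 0" for n
    using i(3)[of n] by (metis \<tau>_def le_less_trans of_nat_0_le_iff powr_ge_zero zero_less_mult_pos less_eq_real_def mult_zero_left)
  have x1: "x n \<ge> 1" for n
    using i(2)[of n] \<tau>0[of n] r_pos unfolding x_def \<tau>_def
    by (simp add: powr_minus one_le_inverse_iff powr_le1)
  have mx: "x n \<le> real (m n)" "real (m n) \<le> 2 * x n" for n
    using x1[of n] unfolding m_def by linarith+
  have m1: "m n \<ge> 1" for n using mx(1)[of n] x1[of n] by linarith
  have sx: "x n powr (- r) = sqrt (\<tau> n)" for n
    using r_pos \<tau>0[of n] by (simp add: x_def powr_powr powr_half_sqrt)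
  have gL: "g n \<in> L2" and ng: "l2norm (g n) = sqrt (\<tau> n)" and gz: "1 \<le> j \<Longrightarrow> j \<le> i n \<Longrightarrow> ip (g n) (\<phi> j) = 0" for n j
    using f_tilde_L2[OF f(1) a] l2norm_f_tilde[OF f(1) a] ip_f_tilde[OF f(1) a]
    by (auto simp: g_def e_def \<tau>_def)
  have low: "1/2 * real (m n) powr (- r) < l2norm (g n)" for n
  proof -
    have "real (m n) powr (- r) \<le> x n powr (- r)"
      using mx(1)[of n] x1[of n] r_pos by (intro powr_mono2') auto
    then show ?thesis using sx[of n] ng[of n] real_sqrt_gt_zero[OF \<tau>0[of n]] by linarith
  qed
  have up: "l2norm (g n) < (2 powr r + 1) * real (m n) powr (- r)" for n
  proof -
    have "2 powr (- r) * x n powr (- r) = (2 * x n) powr (- r)" by (simp add: powr_mult)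
    also have "\<dots> \<le> real (m n) powr (- r)"
      using mx(2)[of n] m1[of n] r_pos by (intro powr_mono2') auto
    finally have "sqrt (\<tau> n) \<le> 2 powr r * real (m n) powr (- r)"
      unfolding sx by (simp add: powr_minus field_simps)
    moreover have "real (m n) powr (- r) > 0" using m1[of n] by simp
    ultimately show ?thesis unfolding ng distrib_right by linarith
  qed
  have mtop: "filterlim m at_top sequentially"
    unfolding filterlim_at_top
  proof
    fix Z :: nat
    have "(\<lambda>n. \<tau> n) \<longlonglongrightarrow> 0" unfolding \<tau>_def by (rule filterlim_compose[OF tail_tendsto[OF f(1)] itop])
    from tendsto_real_sqrt[OF this] have "\<forall>\<^sub>F n in sequentially. sqrt (\<tau> n) < 1/2 * real (Suc Z) powr (- r)"
      by (intro order_tendstoD(2)) auto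
    then show "\<forall>\<^sub>F n in sequentially. Z \<le> m n"
    proof eventually_elim
      case (elim n)
      show ?case
      proof (rule ccontr)
        assume "\<not> Z \<le> m n"
        then have "real (Suc Z) powr (- r) \<le> real (m n) powr (- r)"
          using m1[of n] r_pos by (intro powr_mono2') auto
        then show False using elim low[of n] ng[of n] by simp
      qed
    qed
  qed
  have shift_le: "shift (m n) (g n) \<le> ((2 powr r + 1)\<^sup>2 * 2 powr (1 - 2 * r) / \<sigma>\<^sup>2) * real n powr (- (1 / (4 * s)))"
    if n: "n \<ge> 1" for n
  proof -
    have "shift (m n) (g n) \<le> real (m n) * ip (g n) (g n) / (\<sigma>\<^sup>2 * sqrt (real (i n)))"
      by (intro shift_upper m1 gL i1 gz)
    also have "\<dots> \<le> real (m n) * ((2 powr r + 1) * real (m n) powr (- r))\<^sup>2 / (\<sigma>\<^sup>2 * sqrt (real (i n)))"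
      unfolding l2norm_sq[symmetric] using up[of n]
      by (intro divide_right_mono mult_left_mono power_mono l2norm_nonneg) auto
    also have "\<dots> = (2 powr r + 1)\<^sup>2 / \<sigma>\<^sup>2 * (real (m n) powr (1 - 2 * r) / sqrt (real (i n)))"
      using m1[of n]
      by (simp add: power_mult_distrib power2_eq_square[of "_ powr _"] powr_diff powr_minus field_simps flip: powr_add)
    also have "\<dots> \<le> (2 powr r + 1)\<^sup>2 / \<sigma>\<^sup>2 * (2 powr (1 - 2 * r) * real n powr (- (1 / (4 * s))))"
    proof (intro mult_left_mono)
      \<comment> \<open>These exponents make the powers of \<open>\<tau> n\<close> in A and B
        cancel, which leaves a negative power of n alone.\<close>
      have e1: "(- 1 / (2 * r)) * (1 - 2 * r) = - (1 / (4 * s))" and e2: "2 * s * (1 / (4 * s)) = 1 / 2"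
        using r_pos r_less s_pos by (auto simp: s_eq field_simps)
      have "real (m n) powr (1 - 2 * r) \<le> (2 * x n) powr (1 - 2 * r)"
        using mx[of n] r_less by (intro powr_mono2) auto
      also have "\<dots> = 2 powr (1 - 2 * r) * \<tau> n powr (- (1 / (4 * s)))"
        unfolding powr_mult x_def powr_powr e1 ..
      finally have A: "real (m n) powr (1 - 2 * r) \<le> 2 powr (1 - 2 * r) * \<tau> n powr (- (1 / (4 * s)))" .
      have "real n / \<tau> n \<le> real (i n) powr (2 * s)"
        using i(3)[of n] \<tau>0[of n] by (simp add: \<tau>_def divide_le_eq)
      then have "(real n / \<tau> n) powr (1 / (4 * s)) \<le> (real (i n) powr (2 * s)) powr (1 / (4 * s))"
        using \<tau>0[of n] s_pos by (intro powr_mono2) auto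
      also have "\<dots> = sqrt (real (i n))" unfolding powr_powr e2 by (simp add: powr_half_sqrt)
      finally have B: "(real n / \<tau> n) powr (1 / (4 * s)) \<le> sqrt (real (i n))" .
      have "real (m n) powr (1 - 2 * r) / sqrt (real (i n)) \<le>
          (2 powr (1 - 2 * r) * \<tau> n powr (- (1 / (4 * s)))) / (real n / \<tau> n) powr (1 / (4 * s))"
        using n \<tau>0[of n] by (intro frac_le A B) auto
      also have "\<dots> = 2 powr (1 - 2 * r) * real n powr (- (1 / (4 * s)))"
        using n \<tau>0[of n] by (simp add: powr_divide powr_minus field_simps)
      finally show "real (m n) powr (1 - 2 * r) / sqrt (real (i n)) \<le> 2 powr (1 - 2 * r) * real n powr (- (1 / (4 * s)))" .
    qed (use sigma_pos in auto)
    finally show ?thesis by (simp add: mult_ac)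
  qed
  have shift0: "(\<lambda>n. shift (m n) (g n)) \<longlonglongrightarrow> 0"
  proof (rule tendsto_sandwich[OF _ _ tendsto_const])
    let ?C = "(2 powr r + 1)\<^sup>2 * 2 powr (1 - 2 * r) / \<sigma>\<^sup>2"
    have "(\<lambda>n. ?C * real n powr (- (1 / (4 * s)))) \<longlonglongrightarrow> ?C * 0"
      using s_pos by (intro tendsto_mult_left tendsto_neg_powr filterlim_real_sequentially) auto
    then show "(\<lambda>n. ?C * real n powr (- (1 / (4 * s)))) \<longlonglongrightarrow> 0" by simp
    show "\<forall>\<^sub>F n in sequentially. shift (m n) (g n) \<le> ?C * real n powr (- (1 / (4 * s)))"
      using eventually_ge_at_top[of 1] by eventually_elim (rule shift_le)
  qed (intro always_eventually allI shift_nonneg m1 gL)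
  let ?F = "\<lambda>n x. prob {\<omega> \<in> space M. S (m n) \<omega> \<le> x}"
  let ?\<Phi> = "cdf std_normal_distribution"
  have F: "(\<lambda>n. ?F n x) \<longlonglongrightarrow> ?\<Phi> x" for x by (rule S_clt[OF m1 mtop])
  have b0: "(\<lambda>n. b (m n) 0) \<longlonglongrightarrow> 0" by (rule filterlim_compose[OF b_0_tendsto_0 mtop])
  have main: "liminf (\<lambda>n. ereal (type1_error M w \<sigma> (m n) (K n) + type2_error M w \<sigma> (m n) (K n) (g n))) \<ge> 1"
    if \<alpha>: "0 < \<alpha>" "\<alpha> < 1" and gen: "\<And>n. generated_by (test_stat \<kappa> \<sigma> \<phi> (m n)) (K n)"
      and t1: "(\<lambda>n. type1_error M w \<sigma> (m n) (K n)) \<longlonglongrightarrow> \<alpha>" for \<alpha> K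
  proof -
    obtain z where z: "?\<Phi> z = 1 - \<alpha>" using std_normal_quantile[of "1 - \<alpha>"] \<alpha> by auto
    obtain c where c: "\<And>n Y. K n Y \<longleftrightarrow> test_stat \<kappa> \<sigma> \<phi> (m n) Y > c n"
      using gen unfolding generated_by_def by metis
    define zn where "zn n = c n / scale (m n)" for n
    have K: "K n = (\<lambda>Y. test_stat \<kappa> \<sigma> \<phi> (m n) Y > scale (m n) * zn n)" for n
      using scale_pos[OF m1[of n]] by (auto simp: c zn_def)
    \<comment> \<open>This limit is the only information on the thresholds; \<open>?F n\<close> is
      increasing, so it determines on which side of a given level \<open>zn n\<close> eventually
      lies.\<close>
    have Fz: "(\<lambda>n. ?F n (zn n)) \<longlonglongrightarrow> 1 - \<alpha>"
      using tendsto_diff[OF tendsto_const[of 1] t1] unfolding K by (simp add: type1_error_eq[OF m1])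
    have lower: "\<forall>\<^sub>F n in sequentially. 1 - \<eta> < type1_error M w \<sigma> (m n) (K n) + type2_error M w \<sigma> (m n) (K n) (g n)"
      if \<eta>: "\<eta> > 0" for \<eta>
    proof -
      \<comment> \<open>Continuity supplies y < z at a cost of less than \<eta>. The gap z - y is
        split into three equal parts: for the deviation of the threshold, for the shift and for the
        linear term.\<close>
      have "(?\<Phi> \<longlongrightarrow> ?\<Phi> z) (at z)" using std_normal_cdf_isCont[of z] by (simp add: isCont_def)
      then have "\<forall>\<^sub>F y in at_left z. ?\<Phi> y > ?\<Phi> z - \<eta>"
        using \<eta> by (intro order_tendstoD(1)) (auto simp: filterlim_at_split)
      then obtain y where y: "y < z" "?\<Phi> y > ?\<Phi> z - \<eta>"
        unfolding eventually_at_left_field using dense[of _ z] by blast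
      define d where "d = (z - y) / 3"
      have "d > 0" using y(1) by (simp add: d_def)
      moreover have "z - 3 * d = y" by (simp add: d_def diff_divide_distrib right_diff_distrib)
      ultimately have d: "d > 0" "z - 3 * d = y" .
      have "?\<Phi> (z - d) < (?\<Phi> (z - d) + (1 - \<alpha>)) / 2" "(?\<Phi> (z - d) + (1 - \<alpha>)) / 2 < 1 - \<alpha>"
        using std_normal_cdf_strict_mono[of "z - d" z] d(1) z by auto
      from order_tendstoD(2)[OF F this(1)] order_tendstoD(1)[OF Fz this(2)]
      have zn: "\<forall>\<^sub>F n in sequentially. z - d < zn n"
      proof eventually_elim
        case (elim n)
        show ?case
        proof (rule ccontr)
          assume "\<not> z - d < zn n"
          then have "?F n (zn n) \<le> ?F n (z - d)" by (intro finite_measure_mono) auto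
          then show False using elim by simp
        qed
      qed
      have "(\<lambda>n. type1_error M w \<sigma> (m n) (K n) + (?F n y - 4 * b (m n) 0 * shift (m n) (g n) / d\<^sup>2))
          \<longlonglongrightarrow> \<alpha> + (?\<Phi> y - 4 * 0 * 0 / d\<^sup>2)"
        using d(1) by (intro tendsto_intros t1 F b0 shift0) auto
      moreover have "\<alpha> + (?\<Phi> y - 4 * 0 * 0 / d\<^sup>2) > 1 - \<eta>" using y(2) z by simp
      ultimately have "\<forall>\<^sub>F n in sequentially. 1 - \<eta> <
          type1_error M w \<sigma> (m n) (K n) + (?F n y - 4 * b (m n) 0 * shift (m n) (g n) / d\<^sup>2)"
        by (rule order_tendstoD(1))
      moreover have "\<forall>\<^sub>F n in sequentially. shift (m n) (g n) < d" by (rule order_tendstoD(2)[OF shift0 d(1)])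
      ultimately show ?thesis using zn
      proof eventually_elim
        case (elim n)
        have "?F n y \<le> ?F n (zn n - 2 * d)"
          using elim(3) d by (intro finite_measure_mono) auto
        moreover have "?F n (zn n - 2 * d) - 4 * b (m n) 0 * shift (m n) (g n) / d\<^sup>2 \<le> type2_error M w \<sigma> (m n) (K n) (g n)"
          unfolding K by (intro type2_error_lower m1 gL d less_imp_le elim(2))
        ultimately show ?case using elim(1) by linarith
      qed
    qed
    show ?thesis unfolding le_Liminf_iff
    proof (intro allI impI)
      fix y :: ereal assume y: "y < 1"
      show "\<forall>\<^sub>F n in sequentially. y < ereal (type1_error M w \<sigma> (m n) (K n) + type2_error M w \<sigma> (m n) (K n) (g n))"
      \<comment> \<open>Below 1 an extended real is either finite or minus infinity; only the finite
        case needs the estimate.\<close>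
      proof (cases y)
        case (real u)
        then have "1 - u > 0" using y by (simp add: one_ereal_def)
        from lower[OF this] show ?thesis by (simp add: real)
      qed (use y in auto)
    qed
  qed
  show ?thesis
  proof (rule exI[of _ i], rule exI[of _ m], rule exI[of _ "1/2"], rule exI[of _ "2 powr r + 1"],
      intro conjI allI impI)
    show "1/2 < 2 powr r + (1::real)" using powr_gt_zero[of 2 r] by linarith
  qed (use i1 m1 itop low up main in \<open>auto simp: g_def\<close>)
qed

end

theorem theorem4p1:
  fixes M :: "'a measure"
    and w :: "(real \<Rightarrow> real) \<Rightarrow> 'a \<Rightarrow> real"
    and \<sigma> r s :: real
    and \<phi> :: "nat \<Rightarrow> real \<Rightarrow> real"
    and \<kappa> :: "nat \<Rightarrow> nat \<Rightarrow> real"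
  assumes "white_noise M w"
    and "\<sigma> > 0"
    and "orthonormal_basis \<phi>"
    and "\<forall>n\<ge>1. summable (\<lambda>j. (\<kappa> (Suc j) n)\<^sup>2)"
    and "assumption_A1 \<kappa>"
    and "assumption_A2 \<kappa> \<sigma>"
    and "assumption_A3 \<kappa>"
    and "assumption_A4 \<kappa>"
    and "assumption_A5 \<kappa> \<sigma>"
    and "0 < r" and "r < 1/2"
    and "s = r / (2 - 4 * r)"
    and "\<exists>c>0. \<exists>C\<ge>c. \<forall>n\<ge>1. c * real n powr (2 - 4 * r) \<le> real (k_index \<kappa> n) \<and>
                          real (k_index \<kappa> n) \<le> C * real n powr (2 - 4 * r)"
  shows "\<forall>P0>0. \<exists>e.
    greedy_sequence (besov_ball \<phi> s P0) e \<and> (\<forall>i\<ge>1. \<exists>a. e i = (\<lambda>t. a * \<phi> i t)) \<and>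
    (\<forall>c>0. \<forall>\<alpha>. 0 < \<alpha> \<and> \<alpha> < 1 \<longrightarrow>
      (\<exists>K. (\<forall>n\<ge>1. generated_by (test_stat \<kappa> \<sigma> \<phi> n) (K n)) \<and>
           (\<lambda>n. type1_error M w \<sigma> n (K n)) \<longlonglongrightarrow> \<alpha> \<and>
           limsup (\<lambda>n. ereal (type1_error M w \<sigma> n (K n) +
             type2_error_sup M w \<sigma> n (K n)
               {g \<in> besov_ball \<phi> s P0. l2norm g \<ge> c * real n powr (- r)})) < 1)) \<and>
    (\<forall>f\<in>L2. f \<notin> besov_space \<phi> s \<longrightarrow>
      (\<exists>(i :: nat \<Rightarrow> nat) (m :: nat \<Rightarrow> nat) c1 C1.
         (\<forall>n. i n \<ge> 1 \<and> m n \<ge> 1) \<and> filterlim i at_top sequentially \<and> 0 < c1 \<and> c1 < C1 \<and>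
         (\<forall>n. c1 * real (m n) powr (- r) < l2norm (f_tilde e f (i n)) \<and>
              l2norm (f_tilde e f (i n)) < C1 * real (m n) powr (- r)) \<and>
         (\<forall>\<alpha> K. 0 < \<alpha> \<and> \<alpha> < 1 \<and>
              (\<forall>n. generated_by (test_stat \<kappa> \<sigma> \<phi> (m n)) (K n)) \<and>
              (\<lambda>n. type1_error M w \<sigma> (m n) (K n)) \<longlonglongrightarrow> \<alpha> \<longrightarrow>
            liminf (\<lambda>n. ereal (type1_error M w \<sigma> (m n) (K n) +
              type2_error M w \<sigma> (m n) (K n) (f_tilde e f (i n)))) \<ge> 1)))"
proof (intro allI impI)
  fix P0 :: real assume P0: "P0 > 0"
  interpret white_noise_detection M w \<sigma> r s \<phi> \<kappa>
    by (rule white_noise_detection.intro; (rule assms | use assms(4) in blast))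
  let ?a = "\<lambda>i. sqrt P0 * real i powr (- s)"
  have a: "?a i \<noteq> 0" if "i \<ge> 1" for i using P0 that by simp
  show "\<exists>e.
    greedy_sequence (besov_ball \<phi> s P0) e \<and> (\<forall>i\<ge>1. \<exists>a. e i = (\<lambda>t. a * \<phi> i t)) \<and>
    (\<forall>c>0. \<forall>\<alpha>. 0 < \<alpha> \<and> \<alpha> < 1 \<longrightarrow>
      (\<exists>K. (\<forall>n\<ge>1. generated_by (test_stat \<kappa> \<sigma> \<phi> n) (K n)) \<and>
           (\<lambda>n. type1_error M w \<sigma> n (K n)) \<longlonglongrightarrow> \<alpha> \<and>
           limsup (\<lambda>n. ereal (type1_error M w \<sigma> n (K n) +
             type2_error_sup M w \<sigma> n (K n)
               {g \<in> besov_ball \<phi> s P0. l2norm g \<ge> c * real n powr (- r)})) < 1)) \<and>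
    (\<forall>f\<in>L2. f \<notin> besov_space \<phi> s \<longrightarrow>
      (\<exists>(i :: nat \<Rightarrow> nat) (m :: nat \<Rightarrow> nat) c1 C1.
         (\<forall>n. i n \<ge> 1 \<and> m n \<ge> 1) \<and> filterlim i at_top sequentially \<and> 0 < c1 \<and> c1 < C1 \<and>
         (\<forall>n. c1 * real (m n) powr (- r) < l2norm (f_tilde e f (i n)) \<and>
              l2norm (f_tilde e f (i n)) < C1 * real (m n) powr (- r)) \<and>
         (\<forall>\<alpha> K. 0 < \<alpha> \<and> \<alpha> < 1 \<and>
              (\<forall>n. generated_by (test_stat \<kappa> \<sigma> \<phi> (m n)) (K n)) \<and>
              (\<lambda>n. type1_error M w \<sigma> (m n) (K n)) \<longlonglongrightarrow> \<alpha> \<longrightarrow>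
            liminf (\<lambda>n. ereal (type1_error M w \<sigma> (m n) (K n) +
              type2_error M w \<sigma> (m n) (K n) (f_tilde e f (i n)))) \<ge> 1)))"
  \<comment> \<open>The same sequence serves both parts. Its factors do not vanish, so its spans are
    those of the first basis functions and the residuals of f are the tails of its
    expansion.\<close>
  proof (intro exI[of _ "\<lambda>i t. ?a i * \<phi> i t"] conjI allI impI ballI)
    show "greedy_sequence (besov_ball \<phi> s P0) (\<lambda>i t. ?a i * \<phi> i t)"
      by (rule greedy_sequence_phi[OF s_pos P0])
    show "\<exists>a. (\<lambda>t. ?a i * \<phi> i t) = (\<lambda>t. a * \<phi> i t)" for i by blast
  next
    fix c \<alpha> :: real assume "c > 0" "0 < \<alpha> \<and> \<alpha> < 1"
    then show "\<exists>K. (\<forall>n\<ge>1. generated_by (test_stat \<kappa> \<sigma> \<phi> n) (K n)) \<and>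
           (\<lambda>n. type1_error M w \<sigma> n (K n)) \<longlonglongrightarrow> \<alpha> \<and>
           limsup (\<lambda>n. ereal (type1_error M w \<sigma> n (K n) +
             type2_error_sup M w \<sigma> n (K n)
               {g \<in> besov_ball \<phi> s P0. l2norm g \<ge> c * real n powr (- r)})) < 1"
      using consistent_tests[OF P0] by blast
  qed (rule undetectable_tails, assumption, assumption, rule a)
qed

end
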